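(* Let $\mathcal{X}$ and $\mathcal{Y}$ be Polish spaces, let $\mathcal{S}=\{\mu_1,\ldots,\mu_{|\mathcal{S}|}\}$ be a finite set of probability measures on $\mathcal{X}$, and let $Q$ be a conditional distribution (stochastic kernel) from $\mathcal{X}$ to $\mathcal{Y}$. For each $\alpha\in\{1,\ldots,|\mathcal{S}|\}$ let $(X_\alpha,Y_\alpha)\sim\mu_\alpha\otimes Q$, and assume $I(X_\alpha;Y_\alpha)<\infty$ for all $\alpha$. Then there exist a random variable $Z$ and a deterministic (measurable) function $g$ such that, for every $\alpha\in\{1,\ldots,|\mathcal{S}|\}$, $Z$ is independent of $X_\alpha$, $Y_\alpha$ can be expressed as $Y_\alpha=g(X_\alpha,Z)$ (i.e. $(X_\alpha,g(X_\alpha,Z))\sim\mu_\alpha\otimes Q$), and $$H(Y_\alpha\mid Z)\le \bar{I}(\mathcal{S},Q)+\log\big(|\mathcal{S}|\cdot(\bar{I}(\mathcal{S},Q)+1)\big)+4 .$$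
   Context: A conditional distribution (stochastic kernel) $Q$ from $\mathcal{X}$ to $\mathcal{Y}$ is a map $x\mapsto Q(\cdot|x)$ into probability measures on $\mathcal{Y}$ such that $x\mapsto Q(A|x)$ is measurable for every measurable $A\subseteq\mathcal{Y}$. For a probability measure $\mu$ on $\mathcal{X}$, $\mu\otimes Q$ denotes the joint law of $(X,Y)$ with $X\sim\mu$ and $Y|X=x\sim Q(\cdot|x)$, and $I(\mu,Q)$ denotes the mutual information of $(X,Y)\sim\mu\otimes Q$. For a set $\mathcal{S}$ of probability measures on $\mathcal{X}$, $\bar{I}(\mathcal{S},Q)=\sup_{\mu\in\mathcal{S}}I(\mu,Q)$. $H(\cdot\mid\cdot)$ is (discrete) conditional entropy; logarithms and entropies are in bits. *)

theory Defs
  imports "HOL-Probability.Probability"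
begin

definition borel_prob :: "'a::topological_space measure \<Rightarrow> bool" where
  "borel_prob \<mu> \<longleftrightarrow> prob_space \<mu> \<and> sets \<mu> = sets borel"

definition stoch_kernel :: "('a::topological_space \<Rightarrow> 'b::topological_space measure) \<Rightarrow> bool" where
  "stoch_kernel Q \<longleftrightarrow> (\<forall>x. borel_prob (Q x)) \<and>
     (\<forall>A \<in> sets borel. (\<lambda>x. emeasure (Q x) A) \<in> borel_measurable borel)"

definition joint_law :: "'a::topological_space measure \<Rightarrow> ('a \<Rightarrow> 'b::topological_space measure)
    \<Rightarrow> ('a \<times> 'b) measure" where
  "joint_law \<mu> Q = \<mu> \<bind> (\<lambda>x. distr (Q x) (borel \<Otimes>\<^sub>M borel) (\<lambda>y. (x, y)))"

text \<open>Mutual information (in bits) between the two coordinates of a joint law P,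
  with value \<infinity> when the Kullback-Leibler divergence is infinite, i.e. when P is not
  absolutely continuous w.r.t. the product of its marginals or the log-density is not
  integrable.\<close>
definition mutual_info :: "('a::topological_space \<times> 'b::topological_space) measure \<Rightarrow> ereal" where
  "mutual_info P =
     (let R = distr P borel fst \<Otimes>\<^sub>M distr P borel snd in
      if absolutely_continuous R P \<and> integrable P (entropy_density 2 R P)
      then ereal (prob_space.mutual_information P 2 borel borel fst snd)
      else \<infinity>)"

definition I_kernel :: "'a::topological_space measure \<Rightarrow> ('a \<Rightarrow> 'b::topological_space measure) \<Rightarrow> ereal" where
  "I_kernel \<mu> Q = mutual_info (joint_law \<mu> Q)"

definition I_bar :: "'a::topological_space measure set \<Rightarrow> ('a \<Rightarrow> 'b::topological_space measure) \<Rightarrow> ereal" where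
  "I_bar S Q = (SUP \<mu>\<in>S. I_kernel \<mu> Q)"

definition disc_entropy :: "'b measure \<Rightarrow> ennreal" where
  "disc_entropy P =
     (if (\<integral>\<^sup>+ y. emeasure P {y} \<partial>count_space UNIV) = 1
      then (\<integral>\<^sup>+ y. ennreal (- measure P {y} * log 2 (measure P {y})) \<partial>count_space UNIV)
      else \<infinity>)"

text \<open>Conditional entropy H(Y|Z) of a joint law P of (Y,Z):
  the average over Z of the discrete entropy of the conditional law of Y given Z = z,
  for a regular conditional distribution (disintegration kernel) K.  Different versions of K
  agree almost everywhere, so the infimum is just the common value (and it is \<infinity>
  if no disintegration exists).\<close>
definition cond_entropy :: "('b::topological_space \<times> 'c::topological_space) measure \<Rightarrow> ennreal" where
  "cond_entropy P =
     (INF K \<in> {K. stoch_kernel K \<and>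
                  P = distr P borel snd \<bind> (\<lambda>z. distr (K z) (borel \<Otimes>\<^sub>M borel) (\<lambda>y. (y, z)))}.
        \<integral>\<^sup>+ z. disc_entropy (K z) \<partial>distr P borel snd)"

end

theory Submission
  imports Defs
begin

text \<open>
  Let \<open>R\<close> be a probability measure on \<open>\<Y>\<close> that dominates all output laws and let \<open>W x\<close> be the density
  of \<open>Q x\<close> with respect to \<open>R\<close>; a sample of \<open>Q x\<close> is the first coordinate of a uniform point below
  the graph of \<open>W x\<close>.  The common randomness is an i.i.d.\ array of points \<open>(y, u)\<close> with law
  \<open>R \<otimes> U[0,1]\<close>, the entry at \<open>(i, j)\<close> being read as the point \<open>(y, j + u)\<close> of \<open>\<Y> \<times> [0, \<infinity>)\<close>, so that each
  row has intensity \<open>R \<otimes> Lebesgue\<close>.  In row \<open>i\<close> the first entry below a slightly lowered graph is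
  accepted, the lowering being such that each row accepts with probability \<open>1/2\<close> and the accepted
  point has the required law; the first row that accepts determines the output.

  For the entropy under an input law with output density \<open>r\<close>, the entry \<open>(i, j)\<close> is encoded with the
  weight \<open>2^-(i+1) a (1 + (j + u) / r y)^-(1+a)\<close>.  The expected total weight is \<open>1\<close>, the row costs two
  bits, and the height is below \<open>W x y\<close>, where \<open>log (W x y / r y)\<close> is the information density.  As
  \<open>log (1 + v) \<le> log v + 1\<close> on average, the cost is at most \<open>2 - log a + (1 + a) (I + 1)\<close>, and
  \<open>a = 1 / (I + 1)\<close> gives \<open>I + log (I + 1) + 4\<close>.  The code depends on the input law, the sampler does
  not.
\<close>

section \<open>Polish spaces as measurable retracts of the line\<close>

text \<open>One sampler has to serve every input law, while a short description of the output has to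
  know the output law. Conditioning on the array separates the two: once the array is known the
  output is a function of the accepted index, so weights on the indices chosen for one input law
  bound the entropy by Gibbs' inequality without any change to the sampler. These weights are
  random, and their sum is 1 only in the mean; the excess enters Gibbs' inequality linearly and
  therefore cancels after integration over the array. A density can be unbounded, so the heights are
  cut into unit intervals, one for each column. Scanning the columns in order would by itself favour
  the lower ones, and the lowering of the graph compensates for the chance of having stopped
  earlier: if a row is to stop in column \<open>j\<close> with probability \<open>c\<close> times
  the mass of that layer, the layer has to be divided by \<open>1 / c\<close> minus the mass below
  it. The quotient is a probability for every density once this divisor is at least 1, which allows
  \<open>c\<close> up to \<open>1/2\<close>.\<close>

instance prod :: (polish_space, polish_space) polish_space ..

text \<open>With digits 0 and 1 only, every tail of a ternary expansion lies in [0, 1/2]. The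
  fractional part of \<open>3 ^ m * x\<close> is therefore the tail that starts at digit
  \<open>m\<close>; it lies in [0, 1/6] or in [1/3, 1/2] according to that digit, and 1/4 separates
  the two. Binary digits would leave the ambiguity of dyadic numbers.\<close>

lemma ternary_digit:
  fixes b :: "nat \<Rightarrow> bool"
  shows "1/4 \<le> frac (3 ^ m * (\<Sum>i. of_bool (b i) * (1/3) ^ Suc i :: real)) \<longleftrightarrow> b m"
proof -
  have geo: "(\<lambda>i. (1/3) ^ Suc i :: real) sums (1/2)"
    using sums_mult[OF geometric_sums[of "1/3::real"], of "1/3"] by simp
  have sm: "summable (\<lambda>i. of_bool (d i) * (1/3) ^ Suc i :: real)" for d :: "nat \<Rightarrow> bool"
    by (rule summable_comparison_test'[OF sums_summable[OF geo], of 0]) auto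
  define x where "x d = (\<Sum>i. of_bool (d i) * (1/3) ^ Suc i :: real)" for d
  have x0: "0 \<le> x d" and x1: "x d \<le> 1/2" for d
    using suminf_nonneg[OF sm, of d] suminf_le[OF _ sm sums_summable[OF geo], of d] sums_unique[OF geo]
    by (auto simp: x_def)
  have step: "x d = of_bool (d 0) / 3 + x (\<lambda>i. d (Suc i)) / 3" for d
  proof -
    have "x d = of_bool (d 0) * (1/3) ^ Suc 0 + (\<Sum>i. of_bool (d (Suc i)) * (1/3) ^ Suc (Suc i))"
      unfolding x_def by (subst suminf_split_head[OF sm]) simp
    also have "(\<Sum>i. of_bool (d (Suc i)) * (1/3) ^ Suc (Suc i)) = x (\<lambda>i. d (Suc i)) / 3"
      unfolding x_def by (subst suminf_divide[OF sm, symmetric]) (simp add: mult.commute)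
    finally show ?thesis by simp
  qed
  have "\<exists>k::int. 3 ^ m * x d = of_int k + x (\<lambda>i. d (i + m))" for d
  proof (induction m arbitrary: d)
    case (Suc m)
    obtain k :: int where k: "3 ^ m * x (\<lambda>i. d (Suc i)) = of_int k + x (\<lambda>i. d (Suc (i + m)))"
      using Suc[of "\<lambda>i. d (Suc i)"] by auto
    have "3 ^ Suc m * x d = 3 ^ m * of_bool (d 0) + 3 ^ m * x (\<lambda>i. d (Suc i))"
      by (subst step) (simp add: algebra_simps)
    also have "\<dots> = of_int (3 ^ m * of_bool (d 0) + k) + x (\<lambda>i. d (i + Suc m))"
      unfolding k by (cases "d 0") auto
    finally show ?case by blast
  qed (auto intro!: exI[of _ 0])
  then obtain k :: int where k: "3 ^ m * x b = of_int k + x (\<lambda>i. b (i + m))" by blast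
  have "frac (3 ^ m * x b) = x (\<lambda>i. b (i + m))"
    unfolding k using x0 x1[of "\<lambda>i. b (i + m)"] by (intro frac_unique_iff[THEN iffD2]) (auto)
  then show ?thesis
    using step[of "\<lambda>i. b (i + m)"] x0[of "\<lambda>i. b (Suc i + m)"] x1[of "\<lambda>i. b (Suc i + m)"]
    unfolding x_def[of b, symmetric] by (cases "b m") auto
qed

text \<open>The ternary digits of \<open>e x\<close> record which points of a countable dense
  sequence lie within \<open>(1/2) ^ k\<close> of \<open>x\<close>, for all \<open>k\<close>;
  \<open>d\<close> reads off one such point for each \<open>k\<close> and passes to the limit. Since
  the type of arrays is Polish, a single real number can carry the whole common randomness.\<close>

lemma polish_retract_of_real:
  obtains e :: "'c::polish_space \<Rightarrow> real" and d :: "real \<Rightarrow> 'c"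
  where "e \<in> borel_measurable borel" "d \<in> borel_measurable borel" "\<And>x. d (e x) = x"
proof -
  obtain T :: "'c set" where T: "countable T" "\<And>X. open X \<Longrightarrow> X \<noteq> {} \<Longrightarrow> \<exists>t\<in>T. t \<in> X"
    using countable_dense_setE by metis
  have "T \<noteq> {}" using T(2)[of UNIV] by auto
  define D where "D = from_nat_into T"
  have dense: "\<exists>n. dist x (D n) < (1/2) ^ k" for x k
  proof -
    obtain t where "t \<in> T" "t \<in> ball x ((1/2)^k)" using T(2)[of "ball x ((1/2)^k)"]
      by (metis centre_in_ball empty_iff open_ball zero_less_power zero_less_divide_1_iff zero_less_numeral)
    then show ?thesis using from_nat_into_surj[OF T(1)] by (auto simp: D_def)
  qed
  define bit where "bit x m \<longleftrightarrow> dist x (D (snd (prod_decode m))) < (1/2) ^ fst (prod_decode m)" for x m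
  define e where "e x = (\<Sum>i. of_bool (bit x i) * (1/3) ^ Suc i :: real)" for x
  define c where "c z k = D (LEAST n. 1/4 \<le> frac (3 ^ prod_encode (k, n) * z))" for z :: real and k
  \<comment> \<open>The default value off the Cauchy sequences makes \<open>d\<close> an everywhere
    limit of measurable functions, so the range of \<open>e\<close> does not have to be
    described.\<close>
  define d where "d z = (if Cauchy (c z) then lim (c z) else undefined)" for z
  have [measurable]: "Measurable.pred borel (\<lambda>x. bit x m)" for m
    unfolding bit_def by measurable
  have e: "e \<in> borel_measurable borel"
    unfolding e_def of_bool_def by measurable
  have [measurable]: "(\<lambda>z. c z k) \<in> borel_measurable borel" for k
  proof -
    have "(\<lambda>z. LEAST n. 1/4 \<le> frac (3 ^ prod_encode (k, n) * z)) \<in> measurable (borel :: real measure) (count_space UNIV)"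
      unfolding frac_def by measurable
    then show ?thesis unfolding c_def
      by (rule measurable_compose) simp
  qed
  have d: "d \<in> borel_measurable borel"
  proof (rule borel_measurable_LIMSEQ_metric)
    fix k show "(\<lambda>z. if Cauchy (c z) then c z k else undefined) \<in> borel_measurable borel"
      by measurable
  next
    fix z show "(\<lambda>k. if Cauchy (c z) then c z k else undefined) \<longlonglongrightarrow> d z"
      by (auto simp: d_def dest: Cauchy_convergent convergent_LIMSEQ_iff[THEN iffD1])
  qed
  have "d (e x) = x" for x
  proof -
    have "1/4 \<le> frac (3 ^ prod_encode (k, n) * e x) \<longleftrightarrow> dist x (D n) < (1/2)^k" for k n
      unfolding e_def ternary_digit by (simp add: bit_def)
    then have "dist x (c (e x) k) < (1/2)^k" for k
      unfolding c_def using LeastI_ex[OF dense[of x k]] by simp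
    then have "dist (c (e x) k) x \<le> (1/2)^k" for k
      by (simp add: dist_commute less_imp_le)
    then have "(\<lambda>k. dist (c (e x) k) x) \<longlonglongrightarrow> 0"
      by (intro tendsto_sandwich[OF _ _ tendsto_const LIMSEQ_realpow_zero[of "1/2"]]) auto
    then have "c (e x) \<longlonglongrightarrow> x" by (simp add: tendsto_dist_iff[symmetric])
    then show ?thesis
      unfolding d_def using LIMSEQ_imp_Cauchy limI by metis
  qed
  then show thesis using that e d by blast
qed

section \<open>The array of proposals\<close>

lemma component_borel_measurable:
  "(\<lambda>f :: 'i \<Rightarrow> 'c::topological_space. f k) \<in> borel_measurable borel"
  by (intro borel_measurable_continuous_onI continuous_on_product_coordinates)

lemma component2_borel_measurable:
  "(\<lambda>f :: 'i \<Rightarrow> 'j \<Rightarrow> 'c::topological_space. f k l) \<in> borel_measurable borel"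
  using component_borel_measurable component_borel_measurable by (rule measurable_compose)

lemma suminf_half: "(\<Sum>i. ennreal ((1/2) ^ Suc i)) = 1"
proof -
  have "(\<lambda>i. (1/2) ^ Suc i :: real) sums 1" by (rule power_half_series)
  then show ?thesis by (intro suminf_ennreal_eq[THEN trans]) auto
qed

text \<open>The event is a finite-dimensional cylinder of the product measure. The formula serves
  twice: for the entries of a row and for the rows of the array.\<close>

lemma first_hit_prob:
  assumes M: "prob_space M" and A: "\<And>k. A k \<in> sets M" and B: "B \<in> sets M"
  shows "emeasure (PiM UNIV (\<lambda>_::nat. M)) {\<omega>\<in>space (PiM UNIV (\<lambda>_::nat. M)). (\<forall>k<n. \<omega> k \<notin> A k) \<and> \<omega> n \<in> B}
    = (\<Prod>k<n. 1 - emeasure M (A k)) * emeasure M B"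
proof -
  interpret prob_space M by fact
  interpret P: product_prob_space "\<lambda>_::nat. M" UNIV by unfold_locales
  let ?X = "\<lambda>k. if k = n then B else space M - A k"
  have "{\<omega>\<in>space (PiM UNIV (\<lambda>_::nat. M)). (\<forall>k<n. \<omega> k \<notin> A k) \<and> \<omega> n \<in> B}
      = {\<omega>\<in>space (PiM UNIV (\<lambda>_::nat. M)). \<forall>k\<in>{..n}. \<omega> k \<in> ?X k}"
    by (auto simp: space_PiM PiE_iff)
  also have "emeasure (PiM UNIV (\<lambda>_::nat. M)) \<dots> = (\<Prod>k\<in>{..n}. emeasure M (?X k))"
    using A B by (intro P.emeasure_PiM_Collect) auto
  also have "\<dots> = (\<Prod>k<n. emeasure M (?X k)) * emeasure M B"
    by (simp add: lessThan_Suc_atMost[symmetric] mult.commute)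
  also have "(\<Prod>k<n. emeasure M (?X k)) = (\<Prod>k<n. 1 - emeasure M (A k))"
    using A by (intro prod.cong) (auto simp: emeasure_compl emeasure_space_1)
  finally show ?thesis .
qed

text \<open>The vertical extent over \<open>y\<close> of that part of the region below
  \<open>w\<close> which lies in the strip from \<open>j\<close> to \<open>j + 1\<close>.\<close>

definition cell :: "('b \<Rightarrow> real) \<Rightarrow> nat \<Rightarrow> 'b \<Rightarrow> real" where
  "cell w j y = max 0 (min 1 (w y - real j))"

lemma cell_bounds: "0 \<le> cell w j y" "cell w j y \<le> 1"
  by (auto simp: cell_def)

lemma cell_sums: "0 \<le> w y \<Longrightarrow> (\<lambda>j. cell w j y) sums w y"
proof -
  assume w: "0 \<le> w y"
  have part: "(\<Sum>j<n. cell w j y) = min (real n) (w y)" for n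
    using w by (induction n) (auto simp: cell_def)
  have "eventually (\<lambda>n. min (real n) (w y) = w y) sequentially"
    using eventually_ge_at_top[of "nat \<lceil>w y\<rceil>"] by eventually_elim linarith
  then show ?thesis
    unfolding sums_def part by (rule tendsto_eventually)
qed

lemma cell_measurable[measurable]:
  assumes [measurable]: "w \<in> borel_measurable M"
  shows "cell w j \<in> borel_measurable M"
  unfolding cell_def[abs_def] by measurable

text \<open>The sum is the mass of the layers below \<open>j\<close>, later called
  \<open>cum j\<close>, and \<open>2 - cum j\<close> is the divisor that lowers the graph; it is
  multiplied out to avoid a quotient. The test on the sign of \<open>snd p\<close> lets acceptance
  imply the position of the point without an exceptional null set.\<close>

definition acc :: "'b measure \<Rightarrow> ('b \<Rightarrow> real) \<Rightarrow> nat \<Rightarrow> 'b \<times> real \<Rightarrow> bool" where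
  "acc R w j p \<longleftrightarrow> 0 \<le> snd p \<and> snd p * (2 - (\<Sum>k<j. \<integral>y. cell w k y \<partial>R)) < cell w j (fst p)"

definition proposal :: "'b measure \<Rightarrow> ('b \<times> real) measure" where
  "proposal R = R \<Otimes>\<^sub>M uniform_measure lborel {0..1}"

definition block :: "'b measure \<Rightarrow> (nat \<Rightarrow> 'b \<times> real) measure" where
  "block R = PiM UNIV (\<lambda>_. proposal R)"

definition array :: "'b measure \<Rightarrow> (nat \<Rightarrow> nat \<Rightarrow> 'b \<times> real) measure" where
  "array R = PiM UNIV (\<lambda>_. block R)"

locale borel_prob_space = prob_space R for R :: "'b::polish_space measure" +
  assumes sets_R[measurable_cong, simp]: "sets R = sets borel"
begin

lemma space_R[simp]: "space R = UNIV"
  using sets_eq_imp_space_eq[OF sets_R] by simp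

lemma sets_proposal[measurable_cong, simp]: "sets (proposal R) = sets borel"
  unfolding proposal_def by (subst borel_prod[symmetric]) (intro sets_pair_measure_cong; simp)

lemma prob_space_uniform01: "prob_space (uniform_measure lborel {0..1::real})"
  by (intro prob_space_uniform_measure) auto

lemma prob_space_proposal: "prob_space (proposal R)"
  unfolding proposal_def by (intro prob_space_pair prob_space_axioms prob_space_uniform01)

lemma sets_block[measurable_cong, simp]: "sets (block R) = sets borel"
  unfolding block_def sets_PiM_equal_borel[symmetric] by (intro sets_PiM_cong) simp_all

lemma prob_space_block: "prob_space (block R)"
  unfolding block_def by (intro prob_space_PiM prob_space_proposal)

lemma sets_array[measurable_cong, simp]: "sets (array R) = sets borel"
  unfolding array_def sets_PiM_equal_borel[symmetric] by (intro sets_PiM_cong) simp_all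

lemma prob_space_array: "prob_space (array R)"
  unfolding array_def by (intro prob_space_PiM prob_space_block)

lemma space_proposal[simp]: "space (proposal R) = UNIV"
  and space_block[simp]: "space (block R) = UNIV"
  and space_array[simp]: "space (array R) = UNIV"
  using sets_eq_imp_space_eq[OF sets_proposal] sets_eq_imp_space_eq[OF sets_block]
    sets_eq_imp_space_eq[OF sets_array] by simp_all

lemma nn_integral_proposal:
  assumes [measurable]: "f \<in> borel_measurable borel"
  shows "(\<integral>\<^sup>+p. f p \<partial>proposal R) = (\<integral>\<^sup>+y. (\<integral>\<^sup>+u. f (y, u) * indicator {0..1} u \<partial>lborel) \<partial>R)"
proof -
  interpret U: prob_space "uniform_measure lborel {0..1::real}" by (rule prob_space_uniform01)
  have [measurable]: "f \<in> borel_measurable (R \<Otimes>\<^sub>M lborel)"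
    using assms sets_proposal unfolding proposal_def
    by (metis borel_prod measurable_cong_sets sets_R sets_lborel sets_pair_measure_cong)
  have "(\<integral>\<^sup>+p. f p \<partial>proposal R) = (\<integral>\<^sup>+y. (\<integral>\<^sup>+u. f (y, u) \<partial>uniform_measure lborel {0..1}) \<partial>R)"
    unfolding proposal_def by (intro U.nn_integral_fst[symmetric]) measurable
  also have "\<dots> = (\<integral>\<^sup>+y. (\<integral>\<^sup>+u. f (y, u) * indicator {0..1} u \<partial>lborel) \<partial>R)"
    by (intro nn_integral_cong, subst nn_integral_uniform_measure) (auto simp: divide_ennreal_def)
  finally show ?thesis .
qed

lemma distr_array_component: "distr (array R) borel (\<lambda>\<omega>. \<omega> i j) = proposal R"
proof -
  interpret N: prob_space "proposal R" by (rule prob_space_proposal)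
  interpret B: prob_space "block R" by (rule prob_space_block)
  interpret PB: product_prob_space "\<lambda>_::nat. proposal R" UNIV by unfold_locales
  interpret PA: product_prob_space "\<lambda>_::nat. block R" UNIV by unfold_locales
  have m: "(\<lambda>\<eta>. \<eta> j) \<in> measurable (block R) (proposal R)"
    unfolding block_def by measurable
  have "distr (array R) borel (\<lambda>\<omega>. \<omega> i j) = distr (array R) (proposal R) ((\<lambda>\<eta>. \<eta> j) \<circ> (\<lambda>\<omega>. \<omega> i))"
    by (intro distr_cong) simp_all
  also have "\<dots> = distr (distr (array R) (block R) (\<lambda>\<omega>. \<omega> i)) (proposal R) (\<lambda>\<eta>. \<eta> j)"
    using m unfolding array_def by (intro distr_distr[symmetric]) measurable
  also have "distr (array R) (block R) (\<lambda>\<omega>. \<omega> i) = block R"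
    unfolding array_def by (rule PA.PiM_component) simp
  also have "distr (block R) (proposal R) (\<lambda>\<eta>. \<eta> j) = proposal R"
    unfolding block_def by (rule PB.PiM_component) simp
  finally show ?thesis .
qed

end

section \<open>The accepted entry\<close>

text \<open>On arrays without any accepted entry \<open>LEAST\<close> is unspecified; by
  \<open>AE_hit\<close> these arrays form a null set.\<close>

definition hit_row :: "'b measure \<Rightarrow> ('b \<Rightarrow> real) \<Rightarrow> (nat \<Rightarrow> nat \<Rightarrow> 'b \<times> real) \<Rightarrow> nat" where
  "hit_row R w \<omega> = (LEAST i. \<exists>j. acc R w j (\<omega> i j))"

definition hit_col :: "'b measure \<Rightarrow> ('b \<Rightarrow> real) \<Rightarrow> (nat \<Rightarrow> nat \<Rightarrow> 'b \<times> real) \<Rightarrow> nat" where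
  "hit_col R w \<omega> = (LEAST j. acc R w j (\<omega> (hit_row R w \<omega>) j))"

definition pick :: "'b measure \<Rightarrow> ('b \<Rightarrow> real) \<Rightarrow> (nat \<Rightarrow> nat \<Rightarrow> 'b \<times> real) \<Rightarrow> 'b" where
  "pick R w \<omega> = fst (\<omega> (hit_row R w \<omega>) (hit_col R w \<omega>))"

text \<open>A single input is held fixed here, with \<open>w\<close> in the role of
  \<open>W x\<close>.\<close>

locale sampler = borel_prob_space R for R :: "'b::polish_space measure" +
  fixes w :: "'b \<Rightarrow> real"
  assumes w_measurable[measurable]: "w \<in> borel_measurable borel"
    and w_nonneg: "0 \<le> w y"
    and w_integral: "(\<integral>\<^sup>+y. w y \<partial>R) = 1"
begin

definition mass :: "nat \<Rightarrow> real" where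
  "mass j = (\<integral>y. cell w j y \<partial>R)"

definition cum :: "nat \<Rightarrow> real" where
  "cum j = (\<Sum>k<j. mass k)"

lemma cell_integrable: "integrable R (cell w j)"
  by (rule integrable_const_bound[of _ 1]) (auto simp: cell_bounds)

lemma mass_nonneg: "0 \<le> mass j"
  unfolding mass_def by (intro integral_nonneg_AE) (auto simp: cell_bounds)

lemma nn_integral_cell: "(\<integral>\<^sup>+y. cell w j y \<partial>R) = ennreal (mass j)"
  unfolding mass_def by (intro nn_integral_eq_integral cell_integrable) (auto simp: cell_bounds)

lemma nn_integral_cells:
  assumes [measurable]: "h \<in> borel_measurable borel"
  shows "(\<Sum>j. \<integral>\<^sup>+y. ennreal (cell w j y) * h y \<partial>R) = (\<integral>\<^sup>+y. ennreal (w y) * h y \<partial>R)"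
proof -
  have "(\<Sum>j. \<integral>\<^sup>+y. ennreal (cell w j y) * h y \<partial>R) = (\<integral>\<^sup>+y. (\<Sum>j. ennreal (cell w j y) * h y) \<partial>R)"
    by (intro nn_integral_suminf[symmetric]) measurable
  also have "\<dots> = (\<integral>\<^sup>+y. ennreal (w y) * h y \<partial>R)"
  proof (intro nn_integral_cong)
    fix y
    have "(\<Sum>j. ennreal (cell w j y)) = w y"
      by (rule suminf_ennreal_eq) (simp_all add: cell_bounds cell_sums w_nonneg)
    then show "(\<Sum>j. ennreal (cell w j y) * h y) = ennreal (w y) * h y"
      by (simp add: ennreal_suminf_multc)
  qed
  finally show ?thesis .
qed

lemma mass_sums: "(\<lambda>j. ennreal (mass j)) sums 1"
  using nn_integral_cells[of "\<lambda>_. 1"] by (simp add: nn_integral_cell w_integral sums_iff)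

lemma cum_le_1: "cum j \<le> 1"
proof -
  have "ennreal (cum j) = (\<Sum>k<j. ennreal (mass k))"
    unfolding cum_def by (simp add: mass_nonneg)
  also have "\<dots> \<le> (\<Sum>k. ennreal (mass k))" by (intro sum_le_suminf) auto
  also have "\<dots> = 1" using mass_sums by (simp add: sums_iff)
  finally show ?thesis by simp
qed

lemma acc_iff: "acc R w j (y, u) \<longleftrightarrow> 0 \<le> u \<and> u * (2 - cum j) < cell w j y"
  by (simp add: acc_def cum_def mass_def)

text \<open>As \<open>2 - cum j\<close> is at least 1, the lowered graph stays below the graph of
  \<open>w\<close>. These two bounds are all that the code length later uses about the accepted
  height.\<close>

lemma acc_imp_less:
  assumes "acc R w j (y, u)"
  shows "0 \<le> u" "real j + u < w y"
proof -
  have u: "0 \<le> u" "u * (2 - cum j) < cell w j y" using assms by (auto simp: acc_iff)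
  have "u * 1 \<le> u * (2 - cum j)" using u(1) cum_le_1[of j] by (intro mult_left_mono) auto
  then show "0 \<le> u" "real j + u < w y" using u by (auto simp: cell_def max_def min_def split: if_splits)
qed

lemma acc_measurable[measurable]: "Measurable.pred borel (acc R w j)"
proof -
  have "Measurable.pred (borel \<Otimes>\<^sub>M borel) (acc R w j)"
    unfolding acc_def[abs_def] by measurable
  then show ?thesis by (simp add: borel_prod)
qed

text \<open>For fixed \<open>y\<close> the accepted \<open>u\<close> form the interval from 0 to
  \<open>cell w j y / (2 - cum j)\<close>. Its right end is at most 1, so the uniform law on [0, 1]
  gives it its full length.\<close>

lemma emeasure_acc:
  assumes [measurable]: "C \<in> sets borel"
  shows "emeasure (proposal R) {p. acc R w j p \<and> fst p \<in> C}
    = ennreal (1 / (2 - cum j)) * (\<integral>\<^sup>+y. ennreal (cell w j y) * indicator C y \<partial>R)"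
proof -
  have [measurable]: "fst \<in> borel_measurable (borel :: ('b \<times> real) measure)"
    by (subst borel_prod[symmetric]) measurable
  have c: "0 < 2 - cum j" using cum_le_1[of j] by simp
  have "emeasure (proposal R) {p. acc R w j p \<and> fst p \<in> C}
      = (\<integral>\<^sup>+p. indicator {p. acc R w j p \<and> fst p \<in> C} p \<partial>proposal R)"
    by (intro nn_integral_indicator[symmetric]) simp
  also have "\<dots> = (\<integral>\<^sup>+y. (\<integral>\<^sup>+u. indicator {p. acc R w j p \<and> fst p \<in> C} (y, u) * indicator {0..1} u \<partial>lborel) \<partial>R)"
    by (intro nn_integral_proposal) measurable
  also have "\<dots> = (\<integral>\<^sup>+y. ennreal (1 / (2 - cum j)) * (ennreal (cell w j y) * indicator C y) \<partial>R)"
  proof (intro nn_integral_cong)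
    fix y
    have "cell w j y / (2 - cum j) \<le> 1"
      using c cell_bounds[where w=w and j=j and y=y] cum_le_1[of j] by (simp add: divide_le_eq_1)
    then have u1: "u \<le> 1" if "u < cell w j y / (2 - cum j)" for u
      using that by simp
    have "indicator {p. acc R w j p \<and> fst p \<in> C} (y, u) * indicator {0..1} u
        = indicator {0..<cell w j y / (2 - cum j)} u * (indicator C y :: ennreal)" for u
      using c u1[of u] by (auto simp: acc_iff indicator_def pos_less_divide_eq)
    then have "(\<integral>\<^sup>+u. indicator {p. acc R w j p \<and> fst p \<in> C} (y, u) * indicator {0..1} u \<partial>lborel)
        = (\<integral>\<^sup>+u. indicator {0..<cell w j y / (2 - cum j)} u * indicator C y \<partial>lborel)"
      by simp
    also have "\<dots> = ennreal (cell w j y / (2 - cum j)) * indicator C y"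
      using c cell_bounds[where w=w and j=j and y=y] by (subst nn_integral_multc) auto
    also have "\<dots> = ennreal (1 / (2 - cum j)) * (ennreal (cell w j y) * indicator C y)"
      using c cell_bounds[where w=w and j=j and y=y]
      by (simp add: mult.assoc[symmetric] ennreal_mult[symmetric])
    finally show "(\<integral>\<^sup>+u. indicator {p. acc R w j p \<and> fst p \<in> C} (y, u) * indicator {0..1} u \<partial>lborel)
        = ennreal (1 / (2 - cum j)) * (ennreal (cell w j y) * indicator C y)" .
  qed
  also have "\<dots> = ennreal (1 / (2 - cum j)) * (\<integral>\<^sup>+y. ennreal (cell w j y) * indicator C y \<partial>R)"
    by (intro nn_integral_cmult) measurable
  finally show ?thesis .
qed

text \<open>The thresholds in \<^const>\<open>acc\<close> are chosen so that this product telescopes.\<close>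

lemma prod_reject: "(\<Prod>k<j. 1 - emeasure (proposal R) {p. acc R w k p}) = ennreal ((2 - cum j) / 2)"
proof (induction j)
  case (Suc j)
  have c: "cum j \<le> 1" "cum (Suc j) \<le> 1" "0 \<le> mass j" "cum (Suc j) = cum j + mass j"
    using cum_le_1[of j] cum_le_1[of "Suc j"] mass_nonneg by (simp_all add: cum_def)
  have "1 - emeasure (proposal R) {p. acc R w j p} = 1 - ennreal (mass j / (2 - cum j))"
    using emeasure_acc[of UNIV j] c by (simp add: nn_integral_cell ennreal_mult[symmetric])
  also have "\<dots> = ennreal (1 - mass j / (2 - cum j))"
    using c by (subst ennreal_1[symmetric], subst ennreal_minus) auto
  also have "1 - mass j / (2 - cum j) = (2 - cum (Suc j)) / (2 - cum j)"
    using c by (simp add: field_simps)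
  finally have "1 - emeasure (proposal R) {p. acc R w j p} = ennreal ((2 - cum (Suc j)) / (2 - cum j))" .
  moreover have "(2 - cum j) / 2 * ((2 - cum (Suc j)) / (2 - cum j)) = (2 - cum (Suc j)) / 2"
  proof -
    have half: "a / 2 * (b / a) = b / 2" if "a \<noteq> 0" for a b :: real using that by simp
    show ?thesis by (rule half) (use c(1) in linarith)
  qed
  ultimately show ?case
    using c(1,2) by (simp add: Suc.IH ennreal_mult[symmetric] del: times_divide_eq_right times_divide_eq_left)
qed (simp add: cum_def)

section \<open>Acceptance within one row\<close>

definition blk_hit :: "nat \<Rightarrow> 'b set \<Rightarrow> (nat \<Rightarrow> 'b \<times> real) set" where
  "blk_hit j C = {\<eta>. (\<forall>k<j. \<not> acc R w k (\<eta> k)) \<and> acc R w j (\<eta> j) \<and> fst (\<eta> j) \<in> C}"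

text \<open>The probability \<open>(2 - cum j) / 2\<close> of reaching column \<open>j\<close>
  cancels against the divisor in the acceptance rule. What remains is half of layer
  \<open>j\<close>, with the same factor for every column, so the order of scanning leaves no
  bias.\<close>

lemma emeasure_blk_hit:
  assumes [measurable]: "C \<in> sets borel"
  shows "emeasure (block R) (blk_hit j C) = ennreal (1/2) * (\<integral>\<^sup>+y. ennreal (cell w j y) * indicator C y \<partial>R)"
proof -
  have [measurable]: "fst \<in> borel_measurable (borel :: ('b \<times> real) measure)"
    by (subst borel_prod[symmetric]) measurable
  have c: "0 < 2 - cum j" using cum_le_1[of j] by simp
  have "blk_hit j C = {\<eta>\<in>space (PiM UNIV (\<lambda>_::nat. proposal R)).
      (\<forall>k<j. \<eta> k \<notin> {p. acc R w k p}) \<and> \<eta> j \<in> {p. acc R w j p \<and> fst p \<in> C}}"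
    by (auto simp: blk_hit_def space_PiM)
  then have "emeasure (block R) (blk_hit j C)
      = (\<Prod>k<j. 1 - emeasure (proposal R) {p. acc R w k p}) * emeasure (proposal R) {p. acc R w j p \<and> fst p \<in> C}"
    unfolding block_def by (simp only:) (intro first_hit_prob prob_space_proposal; simp)
  also have "\<dots> = ennreal ((2 - cum j) / 2) * (ennreal (1 / (2 - cum j)) * (\<integral>\<^sup>+y. ennreal (cell w j y) * indicator C y \<partial>R))"
    by (simp add: prod_reject emeasure_acc)
  also have "\<dots> = ennreal (1/2) * (\<integral>\<^sup>+y. ennreal (cell w j y) * indicator C y \<partial>R)"
    using c by (subst mult.assoc[symmetric], subst ennreal_mult[symmetric]) (auto simp: field_simps simp del: ennreal_half)
  finally show ?thesis .
qed

lemma blk_hit_sets[measurable]: "C \<in> sets borel \<Longrightarrow> blk_hit j C \<in> sets borel"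
proof -
  assume [measurable]: "C \<in> sets borel"
  have [measurable]: "fst \<in> borel_measurable (borel :: ('b \<times> real) measure)"
    by (subst borel_prod[symmetric]) measurable
  note component_borel_measurable[measurable]
  have "Measurable.pred borel (\<lambda>\<eta>::nat \<Rightarrow> 'b \<times> real. (\<forall>k<j. \<not> acc R w k (\<eta> k)) \<and> acc R w j (\<eta> j) \<and> fst (\<eta> j) \<in> C)"
    by measurable
  then show ?thesis unfolding blk_hit_def pred_def by simp
qed

text \<open>The layers add up to total mass 1. The value does not depend on \<open>w\<close>, so the
  number of rejected rows is geometric with the same parameter for every input.\<close>

lemma emeasure_blk_any: "emeasure (block R) {\<eta>. \<exists>j. acc R w j (\<eta> j)} = ennreal (1/2)"
proof -
  have "{\<eta>. \<exists>j. acc R w j (\<eta> j)} = (\<Union>j. blk_hit j UNIV)"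
  proof (intro set_eqI iffI)
    fix \<eta> :: "nat \<Rightarrow> 'b \<times> real" assume "\<eta> \<in> {\<eta>. \<exists>j. acc R w j (\<eta> j)}"
    then have "\<exists>j. acc R w j (\<eta> j)" by simp
    from LeastI_ex[OF this] not_less_Least[where P="\<lambda>j. acc R w j (\<eta> j)"] show "\<eta> \<in> (\<Union>j. blk_hit j UNIV)"
      unfolding blk_hit_def by blast
  qed (auto simp: blk_hit_def)
  also have "emeasure (block R) \<dots> = (\<Sum>j. emeasure (block R) (blk_hit j UNIV))"
  proof (intro suminf_emeasure[symmetric])
    show "disjoint_family (\<lambda>j. blk_hit j UNIV)"
      unfolding disjoint_family_on_def blk_hit_def
      using nat_neq_iff by (auto; blast)
  qed auto
  also have "\<dots> = ennreal (1/2) * (\<Sum>j. ennreal (mass j))"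
    by (simp add: emeasure_blk_hit nn_integral_cell)
  also have "\<dots> = ennreal (1/2)"
    using mass_sums by (simp add: sums_iff)
  finally show ?thesis .
qed

section \<open>Acceptance in the whole array\<close>

definition hit :: "nat \<Rightarrow> nat \<Rightarrow> 'b set \<Rightarrow> (nat \<Rightarrow> nat \<Rightarrow> 'b \<times> real) set" where
  "hit i j C = {\<omega>. (\<forall>k<i. \<not> (\<exists>j. acc R w j (\<omega> k j))) \<and> \<omega> i \<in> blk_hit j C}"

lemma blk_any_sets[measurable]: "{\<eta>. \<exists>j. acc R w j (\<eta> j)} \<in> sets borel"
proof -
  note component_borel_measurable[measurable]
  have "Measurable.pred borel (\<lambda>\<eta>::nat \<Rightarrow> 'b \<times> real. \<exists>j. acc R w j (\<eta> j))" by measurable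
  then show ?thesis by (simp add: pred_def)
qed

text \<open>The product form says that the accepting row is independent of the column and the output
  found in it; the row factor is \<open>(1/2) ^ i\<close> for the rejected rows times the
  \<open>1/2\<close> from \<open>emeasure_blk_hit\<close>.\<close>

lemma emeasure_hit:
  assumes [measurable]: "C \<in> sets borel"
  shows "emeasure (array R) (hit i j C) = ennreal ((1/2) ^ Suc i) * (\<integral>\<^sup>+y. ennreal (cell w j y) * indicator C y \<partial>R)"
proof -
  have "hit i j C = {\<omega>\<in>space (PiM UNIV (\<lambda>_::nat. block R)).
      (\<forall>k<i. \<omega> k \<notin> {\<eta>. \<exists>j. acc R w j (\<eta> j)}) \<and> \<omega> i \<in> blk_hit j C}"
    by (auto simp: hit_def space_PiM)
  then have "emeasure (array R) (hit i j C)
      = (\<Prod>k<i. 1 - emeasure (block R) {\<eta>. \<exists>j. acc R w j (\<eta> j)}) * emeasure (block R) (blk_hit j C)"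
    unfolding array_def by (simp only:) (intro first_hit_prob prob_space_block; simp)
  also have "1 - emeasure (block R) {\<eta>. \<exists>j. acc R w j (\<eta> j)} = ennreal (1/2)"
    unfolding emeasure_blk_any by (subst ennreal_1[symmetric], subst ennreal_minus) auto
  also have "(\<Prod>k<i. ennreal (1/2)) = ennreal ((1/2) ^ i)"
    by (simp add: ennreal_power del: ennreal_half)
  also have "ennreal ((1/2) ^ i) * emeasure (block R) (blk_hit j C)
      = ennreal ((1/2) ^ Suc i) * (\<integral>\<^sup>+y. ennreal (cell w j y) * indicator C y \<partial>R)"
    unfolding emeasure_blk_hit[OF assms]
    by (subst mult.assoc[symmetric], subst ennreal_mult[symmetric]) (auto simp: mult.commute)
  finally show ?thesis .
qed

lemma hit_sets[measurable]: "C \<in> sets borel \<Longrightarrow> hit i j C \<in> sets borel"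
proof -
  assume C[measurable]: "C \<in> sets borel"
  note component_borel_measurable[measurable]
  have "Measurable.pred borel (\<lambda>\<omega>::nat \<Rightarrow> nat \<Rightarrow> 'b \<times> real. 
      (\<forall>k<i. \<not> (\<omega> k \<in> {\<eta>. \<exists>j. acc R w j (\<eta> j)})) \<and> \<omega> i \<in> blk_hit j C)"
    by measurable
  then show ?thesis unfolding hit_def pred_def by simp
qed

text \<open>The conjunct \<open>acc R w j (\<omega> i j)\<close> excludes arrays in which nothing is
  accepted, where the two \<open>LEAST\<close> values carry no information.\<close>

lemma hit_eq: "hit i j C = {\<omega>. hit_row R w \<omega> = i \<and> hit_col R w \<omega> = j \<and> pick R w \<omega> \<in> C \<and> acc R w j (\<omega> i j)}"
proof (intro set_eqI iffI)
  fix \<omega> assume h: "\<omega> \<in> hit i j C"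
  then have a: "acc R w j (\<omega> i j)" "fst (\<omega> i j) \<in> C" "\<And>k. k < j \<Longrightarrow> \<not> acc R w k (\<omega> i k)"
    "\<And>k l. k < i \<Longrightarrow> \<not> acc R w l (\<omega> k l)"
    by (auto simp: hit_def blk_hit_def)
  have r: "hit_row R w \<omega> = i" unfolding hit_row_def
    by (rule Least_equality) (use a not_less in blast)+
  have c: "hit_col R w \<omega> = j" unfolding hit_col_def r
    by (rule Least_equality) (use a not_less in blast)+
  show "\<omega> \<in> {\<omega>. hit_row R w \<omega> = i \<and> hit_col R w \<omega> = j \<and> pick R w \<omega> \<in> C \<and> acc R w j (\<omega> i j)}"
    using a r c by (simp add: pick_def)
next
  fix \<omega> assume h: "\<omega> \<in> {\<omega>. hit_row R w \<omega> = i \<and> hit_col R w \<omega> = j \<and> pick R w \<omega> \<in> C \<and> acc R w j (\<omega> i j)}"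
  then have "\<not> acc R w l (\<omega> k l)" if "k < i" for k l
    using that not_less_Least[where P="\<lambda>i. \<exists>j. acc R w j (\<omega> i j)"] unfolding hit_row_def by blast
  moreover have "\<not> acc R w k (\<omega> i k)" if "k < j" for k
    using that h not_less_Least[where P="\<lambda>k. acc R w k (\<omega> i k)"] unfolding hit_col_def by blast
  ultimately show "\<omega> \<in> hit i j C"
    using h by (auto simp: hit_def blk_hit_def pick_def)
qed

end

section \<open>Joint measurability in the input and the array\<close>

context borel_prob_space
begin

text \<open>Each \<open>LEAST\<close> ranges over countably many measurable predicates, and
  evaluating the array at a measurable index is a countable case distinction. Measurability is
  needed jointly in \<open>(x, \<omega>)\<close>, because the input is random as well.\<close>

lemma
  fixes W :: "'a::second_countable_topology \<Rightarrow> 'b \<Rightarrow> real"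
  assumes W: "(\<lambda>(x, y). W x y) \<in> borel_measurable (borel \<Otimes>\<^sub>M borel)"
  shows row_measurable: "(\<lambda>(x, \<omega>). hit_row R (W x) \<omega>) \<in> measurable (borel \<Otimes>\<^sub>M borel) (count_space UNIV)"
    and col_measurable: "(\<lambda>(x, \<omega>). hit_col R (W x) \<omega>) \<in> measurable (borel \<Otimes>\<^sub>M borel) (count_space UNIV)"
    and pick_measurable: "(\<lambda>(x, \<omega>). pick R (W x) \<omega>) \<in> measurable (borel \<Otimes>\<^sub>M borel) borel"
proof -
  let ?M = "borel \<Otimes>\<^sub>M borel :: ('a \<times> (nat \<Rightarrow> nat \<Rightarrow> 'b \<times> real)) measure"
  have comp[measurable]: "(\<lambda>z. snd z i j) \<in> measurable ?M borel" for i j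
    using measurable_snd component2_borel_measurable by (rule measurable_compose)
  have fs: "fst \<in> borel_measurable (borel :: ('b \<times> real) measure)" "snd \<in> borel_measurable (borel :: ('b \<times> real) measure)"
    by (subst borel_prod[symmetric], measurable)+
  have [measurable]: "(\<lambda>z. fst (snd z i j)) \<in> measurable ?M borel" "(\<lambda>z. snd (snd z i j)) \<in> measurable ?M borel" for i j
    using measurable_compose[OF comp fs(1)] measurable_compose[OF comp fs(2)] by auto
  have W2: "(\<lambda>z. W (f z) (g z)) \<in> borel_measurable N"
    if "f \<in> measurable N borel" "g \<in> measurable N borel" for f g and N :: "'n measure"
    using measurable_compose[OF measurable_Pair[OF that] W] by simp
  have [measurable]: "(\<lambda>z. cell (W (fst z)) k (fst (snd z i j))) \<in> borel_measurable ?M" for i j k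
    unfolding cell_def
    by (intro borel_measurable_max borel_measurable_min borel_measurable_diff borel_measurable_const W2) measurable
  \<comment> \<open>This one is for the layer masses inside \<open>acc\<close>: they are integrals
    over \<open>R\<close> whose integrand depends on the input.\<close>
  have [measurable]: "(\<lambda>z. cell (W (fst (fst z))) k (snd z)) \<in> borel_measurable (?M \<Otimes>\<^sub>M R)" for k
    unfolding cell_def
    by (intro borel_measurable_max borel_measurable_min borel_measurable_diff borel_measurable_const W2) measurable
  have a[measurable]: "Measurable.pred ?M (\<lambda>z. acc R (W (fst z)) k (snd z i j))" for i j k
    unfolding acc_def by measurable
  have row[measurable]: "(\<lambda>z. hit_row R (W (fst z)) (snd z)) \<in> measurable ?M (count_space UNIV)"
    unfolding hit_row_def by measurable
  have [measurable]: "Measurable.pred ?M (\<lambda>z. acc R (W (fst z)) j (snd z (hit_row R (W (fst z)) (snd z)) j))" for j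
    by (rule measurable_compose_countable[OF a row])
  have col[measurable]: "(\<lambda>z. hit_col R (W (fst z)) (snd z)) \<in> measurable ?M (count_space UNIV)"
    unfolding hit_col_def by measurable
  have "(\<lambda>z. fst (snd z (hit_row R (W (fst z)) (snd z)) j)) \<in> borel_measurable ?M" for j
    by (rule measurable_compose_countable[OF _ row]) measurable
  then have "(\<lambda>z. pick R (W (fst z)) (snd z)) \<in> borel_measurable ?M"
    unfolding pick_def by (rule measurable_compose_countable[OF _ col])
  then show "(\<lambda>(x, \<omega>). pick R (W x) \<omega>) \<in> measurable ?M borel"
    "(\<lambda>(x, \<omega>). hit_row R (W x) \<omega>) \<in> measurable ?M (count_space UNIV)"
    "(\<lambda>(x, \<omega>). hit_col R (W x) \<omega>) \<in> measurable ?M (count_space UNIV)"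
    using row col by (simp_all add: case_prod_beta')
qed

end

section \<open>Law of the accepted row and of the output\<close>

context sampler
begin

text \<open>A constant family of densities, which specialises the joint measurability statements to
  one fixed density by inserting a dummy first coordinate.\<close>

lemma w_snd_measurable: "(\<lambda>(x, y). w y) \<in> borel_measurable (borel \<Otimes>\<^sub>M borel)"
  by measurable

lemma pick_borel_measurable[measurable]: "pick R w \<in> borel_measurable borel"
  and row_borel_measurable[measurable]: "hit_row R w \<in> measurable borel (count_space UNIV)"
  using measurable_compose[OF measurable_Pair[OF measurable_const[of "0::real"] measurable_ident]
      pick_measurable[OF w_snd_measurable]]
    measurable_compose[OF measurable_Pair[OF measurable_const[of "0::real"] measurable_ident]
      row_measurable[OF w_snd_measurable]]
  by simp_all

text \<open>The events are disjoint for different indices, and their probabilities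
  \<open>(1/2) ^ Suc i * mass j\<close> sum to 1.\<close>

lemma AE_hit: "AE \<omega> in array R. \<exists>i j. \<omega> \<in> hit i j UNIV"
proof -
  interpret A: prob_space "array R" by (rule prob_space_array)
  have "emeasure (array R) (\<Union>i. \<Union>j. hit i j UNIV) = (\<Sum>i. emeasure (array R) (\<Union>j. hit i j UNIV))"
  proof (intro suminf_emeasure[symmetric])
    show "range (\<lambda>i. \<Union>j. hit i j UNIV) \<subseteq> sets (array R)"
      by (intro image_subsetI sets.countable_UN) auto
  qed (auto simp: disjoint_family_on_def hit_eq)
  also have "\<dots> = (\<Sum>i. \<Sum>j. emeasure (array R) (hit i j UNIV))"
  proof (intro suminf_cong suminf_emeasure[symmetric])
    show "range (\<lambda>j. hit i j UNIV) \<subseteq> sets (array R)" for i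
      by (intro image_subsetI) simp
  qed (auto simp: disjoint_family_on_def hit_eq)
  also have "\<dots> = (\<Sum>i. ennreal ((1/2) ^ Suc i) * (\<Sum>j. ennreal (mass j)))"
    by (simp add: emeasure_hit nn_integral_cell del: power_Suc)
  also have "\<dots> = 1"
    using mass_sums suminf_half by (simp add: sums_iff del: power_Suc)
  finally have "AE \<omega> in array R. \<omega> \<in> (\<Union>i. \<Union>j. hit i j UNIV)"
    by (intro A.AE_in_set_eq_1[THEN iffD2]) (auto simp: A.emeasure_eq_measure)
  then show ?thesis by simp
qed

text \<open>Almost every array lies in exactly one of the events \<open>hit i j UNIV\<close>, so an
  expectation splits along the accepted index and the probabilities of \<open>emeasure_hit\<close>
  can be inserted.\<close>

lemma nn_integral_array_hits:
  assumes [measurable]: "f \<in> borel_measurable borel"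
  shows "(\<integral>\<^sup>+\<omega>. f \<omega> \<partial>array R) = (\<Sum>i. \<Sum>j. \<integral>\<^sup>+\<omega>. f \<omega> * indicator (hit i j UNIV) \<omega> \<partial>array R)"
proof -
  have "(\<integral>\<^sup>+\<omega>. f \<omega> \<partial>array R) = (\<integral>\<^sup>+\<omega>. (\<Sum>i. \<Sum>j. f \<omega> * indicator (hit i j UNIV) \<omega>) \<partial>array R)"
  proof (intro nn_integral_cong_AE)
    show "AE \<omega> in array R. f \<omega> = (\<Sum>i. \<Sum>j. f \<omega> * indicator (hit i j UNIV) \<omega>)"
      using AE_hit
    proof eventually_elim
      fix \<omega> assume "\<exists>i j. \<omega> \<in> hit i j UNIV"
      then obtain a b where ab: "\<omega> \<in> hit a b UNIV" by blast
      have *: "indicator (hit i j UNIV) \<omega> = (if i = a \<and> j = b then 1 else 0 :: ennreal)" for i j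
        using ab by (auto simp: hit_eq indicator_def)
      have "(\<Sum>j. f \<omega> * indicator (hit i j UNIV) \<omega>) = (if i = a then f \<omega> else 0)" for i
        unfolding * by (subst suminf_finite[of "{b}"]) auto
      then show "f \<omega> = (\<Sum>i. \<Sum>j. f \<omega> * indicator (hit i j UNIV) \<omega>)"
        by (simp only:) (subst suminf_finite[of "{a}"]; auto)
    qed
  qed
  also have "\<dots> = (\<Sum>i. \<Sum>j. \<integral>\<^sup>+\<omega>. f \<omega> * indicator (hit i j UNIV) \<omega> \<partial>array R)"
    by (simp add: nn_integral_suminf del: ennreal_suminf_cmult)
  finally show ?thesis .
qed

text \<open>In the sum of the probabilities of \<open>hit i j C\<close> the row factors add up to 1
  and the layers recombine to \<open>w\<close>.\<close>

lemma distr_pick: "distr (array R) borel (pick R w) = density R w"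
proof (rule measure_eqI)
  fix C assume "C \<in> sets (distr (array R) borel (pick R w))"
  then have [measurable]: "C \<in> sets borel" by simp
  have "emeasure (distr (array R) borel (pick R w)) C = (\<integral>\<^sup>+\<omega>. indicator C (pick R w \<omega>) \<partial>array R)"
    by (subst nn_integral_indicator[symmetric], simp, subst nn_integral_distr) auto
  also have "\<dots> = (\<Sum>i. \<Sum>j. \<integral>\<^sup>+\<omega>. indicator C (pick R w \<omega>) * indicator (hit i j UNIV) \<omega> \<partial>array R)"
    by (intro nn_integral_array_hits) measurable
  also have "\<dots> = (\<Sum>i. \<Sum>j. emeasure (array R) (hit i j C))"
  proof (intro suminf_cong)
    fix i j
    have "indicator C (pick R w \<omega>) * indicator (hit i j UNIV) \<omega> = (indicator (hit i j C) \<omega> :: ennreal)" for \<omega>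
      by (auto simp: hit_eq indicator_def)
    then show "(\<integral>\<^sup>+\<omega>. indicator C (pick R w \<omega>) * indicator (hit i j UNIV) \<omega> \<partial>array R) = emeasure (array R) (hit i j C)"
      by simp
  qed
  also have "\<dots> = (\<Sum>i. ennreal ((1/2) ^ Suc i) * (\<integral>\<^sup>+y. ennreal (w y) * indicator C y \<partial>R))"
    by (simp add: emeasure_hit nn_integral_cells del: power_Suc)
  also have "\<dots> = (\<integral>\<^sup>+y. ennreal (w y) * indicator C y \<partial>R)"
    using suminf_half by (simp add: ennreal_suminf_multc del: power_Suc)
  also have "\<dots> = emeasure (density R w) C"
    by (simp add: emeasure_density)
  finally show "emeasure (distr (array R) borel (pick R w)) C = emeasure (density R w) C" .
qed simp

text \<open>The mean of a geometric variable. \<open>Suc i\<close> is the code length of the factor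
  \<open>(1/2) ^ Suc i\<close> in the weight, so naming the row costs two bits on average.\<close>

lemma nn_integral_Suc_row: "(\<integral>\<^sup>+\<omega>. of_nat (Suc (hit_row R w \<omega>)) \<partial>array R) = 2"
proof -
  have "(\<integral>\<^sup>+\<omega>. of_nat (Suc (hit_row R w \<omega>)) \<partial>array R)
      = (\<Sum>i. \<Sum>j. \<integral>\<^sup>+\<omega>. of_nat (Suc (hit_row R w \<omega>)) * indicator (hit i j UNIV) \<omega> \<partial>array R)"
    by (intro nn_integral_array_hits) measurable
  also have "\<dots> = (\<Sum>i. \<Sum>j. of_nat (Suc i) * emeasure (array R) (hit i j UNIV))"
  proof (intro suminf_cong)
    fix i j
    have "(\<integral>\<^sup>+\<omega>. of_nat (Suc (hit_row R w \<omega>)) * indicator (hit i j UNIV) \<omega> \<partial>array R)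
        = (\<integral>\<^sup>+\<omega>. of_nat (Suc i) * indicator (hit i j UNIV) \<omega> \<partial>array R)"
      by (intro nn_integral_cong) (auto simp: hit_eq indicator_def)
    then show "(\<integral>\<^sup>+\<omega>. of_nat (Suc (hit_row R w \<omega>)) * indicator (hit i j UNIV) \<omega> \<partial>array R)
        = of_nat (Suc i) * emeasure (array R) (hit i j UNIV)"
      by (simp only:) (intro nn_integral_cmult_indicator, simp)
  qed
  also have "\<dots> = (\<Sum>i. of_nat (Suc i) * (ennreal ((1/2) ^ Suc i) * (\<Sum>j. ennreal (mass j))))"
    by (simp add: emeasure_hit nn_integral_cell del: power_Suc of_nat_Suc)
  also have "\<dots> = (\<Sum>i. ennreal (real (Suc i) * (1/2) ^ Suc i))"
    using mass_sums
    by (simp add: sums_iff ennreal_mult ennreal_of_nat_eq_real_of_nat del: power_Suc of_nat_Suc)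
  also have "\<dots> = 2"
  proof -
    have "(\<lambda>i. 1/2 * (of_nat (Suc i) * (1/2) ^ i :: real)) sums (1/2 * (1 / (1 - 1/2)^2))"
      by (intro sums_mult geometric_deriv_sums) simp
    then have "(\<lambda>i. real (Suc i) * (1/2) ^ Suc i) sums 2"
      by (simp add: power2_eq_square mult.left_commute)
    then show ?thesis by (intro suminf_ennreal_eq[THEN trans]) (auto simp del: of_nat_Suc)
  qed
  finally show ?thesis .
qed

lemma AE_pick:
  "AE \<omega> in array R. 0 \<le> snd (\<omega> (hit_row R w \<omega>) (hit_col R w \<omega>)) \<and>
    real (hit_col R w \<omega>) + snd (\<omega> (hit_row R w \<omega>) (hit_col R w \<omega>)) < w (pick R w \<omega>)"
  using AE_hit
proof eventually_elim
  fix \<omega> assume "\<exists>i j. \<omega> \<in> hit i j UNIV"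
  then have "acc R w (hit_col R w \<omega>) (\<omega> (hit_row R w \<omega>) (hit_col R w \<omega>))" by (auto simp: hit_eq)
  then show "0 \<le> snd (\<omega> (hit_row R w \<omega>) (hit_col R w \<omega>)) \<and>
    real (hit_col R w \<omega>) + snd (\<omega> (hit_row R w \<omega>) (hit_col R w \<omega>)) < w (pick R w \<omega>)"
    using acc_imp_less unfolding pick_def by (metis prod.collapse)
qed

end

section \<open>Code lengths\<close>

text \<open>An index of weight 0 cannot be described, hence the infinite length. For
  \<open>q > 1\<close> the conversion to \<open>ennreal\<close> would cut the negative logarithm off
  at 0, so the weights are kept at most 1 in what follows.\<close>

definition code_len :: "real \<Rightarrow> ennreal" where
  "code_len q = (if q \<le> 0 then \<infinity> else ennreal (- log 2 q))"

lemma code_len_measurable[measurable]: "code_len \<in> borel_measurable borel"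
  unfolding code_len_def[abs_def] by measurable

lemma code_len_mult:
  assumes "0 < a" "a \<le> 1" "q \<le> 1"
  shows "code_len (a * q) = ennreal (- log 2 a) + code_len q"
proof (cases "q \<le> 0")
  case True
  then show ?thesis using assms by (simp add: code_len_def mult_le_0_iff)
next
  case False
  then have "\<not> a * q \<le> 0" using assms by (simp add: mult_le_0_iff)
  then show ?thesis
    using False assms by (simp add: code_len_def log_mult ennreal_plus[symmetric] del: ennreal_plus)
qed

text \<open>This is \<open>ln t \<le> t - 1\<close> at \<open>t = q / a\<close>, together with
  \<open>a \<le> p\<close>. Here \<open>a\<close> is the probability of an index and
  \<open>p\<close> that of the output value found there, which several indices may share. The term
  \<open>a / ln 2\<close> stands on the left so that nothing is subtracted in
  \<open>ennreal\<close>.\<close>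

lemma gibbs_pointwise:
  assumes a: "0 \<le> a" "a \<le> p" "p \<le> 1" and q: "0 \<le> q" "q \<le> 1"
  shows "ennreal a * (code_len p + ennreal (1 / ln 2)) \<le> ennreal a * code_len q + ennreal (1 / ln 2) * ennreal q"
proof (cases "a = 0 \<or> q = 0")
  case True
  then show ?thesis using a by (auto simp: code_len_def ennreal_mult_top)
next
  case False
  then have pos: "0 < a" "0 < q" "0 < p" using a q by auto
  have "ln (q / a) \<le> q / a - 1" using pos by (intro ln_le_minus_one) auto
  then have "a * (ln q - ln a) \<le> a * (q / a - 1)"
    using pos by (intro mult_left_mono) (auto simp: ln_div)
  moreover have "a * ln a \<le> a * ln p" using pos a by (intro mult_left_mono) auto
  moreover have "a * (ln q - ln a) = a * ln q - a * ln a" "a * (q / a - 1) = q - a"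
    using pos by (auto simp: field_simps)
  ultimately have "a * (- ln p) + a \<le> a * (- ln q) + q"
    unfolding mult_minus_right by linarith
  then have "(a * (- ln p) + a) / ln 2 \<le> (a * (- ln q) + q) / ln 2"
    by (intro divide_right_mono) auto
  then have "a * (- log 2 p + 1 / ln 2) \<le> a * (- log 2 q) + 1 / ln 2 * q"
    by (simp add: log_def add_divide_distrib algebra_simps diff_divide_distrib)
  moreover have "0 \<le> - log 2 p" "0 \<le> - log 2 q"
    using pos a q by auto
  moreover have "0 \<le> - log 2 p + 1 / ln 2"
    using \<open>0 \<le> - log 2 p\<close> by (intro add_nonneg_nonneg) auto
  moreover from this have "ennreal a * (code_len p + ennreal (1 / ln 2)) = ennreal (a * (- log 2 p + 1 / ln 2))"
    using pos \<open>0 \<le> - log 2 p\<close> by (subst ennreal_mult) (auto simp: code_len_def ennreal_plus[symmetric] simp del: ennreal_plus)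
  moreover have "ennreal a * code_len q + ennreal (1 / ln 2) * ennreal q = ennreal (a * (- log 2 q) + 1 / ln 2 * q)"
    using pos \<open>0 \<le> - log 2 q\<close>
    by (subst ennreal_plus, simp add: mult_nonneg_nonneg mult_nonneg_nonpos, simp, subst (1 2) ennreal_mult) (auto simp: code_len_def)
  ultimately show ?thesis
    by (simp only: ennreal_leI)
qed

text \<open>Counting measure on an uncountable type is not sigma-finite, so both iterated integrals
  are compared with the one over the counting measure on pairs.\<close>

lemma nn_integral_count_space_swap:
  "(\<integral>\<^sup>+x. (\<integral>\<^sup>+y. f x y \<partial>count_space UNIV) \<partial>count_space UNIV)
    = (\<integral>\<^sup>+y. (\<integral>\<^sup>+x. f x y \<partial>count_space UNIV) \<partial>count_space UNIV)"
  using nn_integral_fst_count_space[of "\<lambda>(x, y). f x y"] nn_integral_snd_count_space[of "\<lambda>(x, y). f x y"]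
  by simp

lemma nn_integral_countable_partition:
  fixes k :: "'x \<Rightarrow> 'i::countable"
  assumes k[measurable]: "k \<in> measurable M (count_space UNIV)"
  shows "(\<integral>\<^sup>+x. f (k x) \<partial>M) = (\<integral>\<^sup>+i. f i * emeasure M {x\<in>space M. k x = i} \<partial>count_space UNIV)"
proof -
  have "(\<integral>\<^sup>+x. f (k x) \<partial>M) = (\<integral>\<^sup>+i. f i \<partial>distr M (count_space UNIV) k)"
    by (rule nn_integral_distr[symmetric]) auto
  also have "distr M (count_space UNIV) k = density (count_space UNIV) (\<lambda>i. emeasure M {x\<in>space M. k x = i})"
  proof (rule measure_eqI_countable[of _ UNIV])
    fix i
    have "k -` {i} \<inter> space M = {x\<in>space M. k x = i}" by auto
    then show "emeasure (distr M (count_space UNIV) k) {i}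
        = emeasure (density (count_space UNIV) (\<lambda>i. emeasure M {x\<in>space M. k x = i})) {i}"
      by (simp add: emeasure_distr emeasure_density)
  qed auto
  also have "(\<integral>\<^sup>+i. f i \<partial>density (count_space UNIV) (\<lambda>i. emeasure M {x\<in>space M. k x = i}))
      = (\<integral>\<^sup>+i. f i * emeasure M {x\<in>space M. k x = i} \<partial>count_space UNIV)"
    by (subst nn_integral_density) (auto simp: mult.commute)
  finally show ?thesis .
qed

text \<open>Gibbs' inequality summed over the indices. The weights \<open>q\<close> need not sum to
  1, or even have a finite sum; the excess of their sum over 1 remains as a linear term that can be
  averaged afterwards.\<close>

lemma disc_entropy_le_code_len:
  fixes k :: "'x \<Rightarrow> 'i::countable" and pt :: "'i \<Rightarrow> 'b::t1_space"
  assumes M: "prob_space M"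
    and k[measurable]: "k \<in> measurable M (count_space UNIV)"
    and q: "\<And>i. 0 \<le> q i" "\<And>i. q i \<le> 1"
  shows "disc_entropy (distr M borel (\<lambda>x. pt (k x))) + ennreal (1 / ln 2)
    \<le> (\<integral>\<^sup>+x. code_len (q (k x)) \<partial>M) + ennreal (1 / ln 2) * (\<integral>\<^sup>+i. q i \<partial>count_space UNIV)"
proof -
  interpret prob_space M by fact
  let ?P = "distr M borel (\<lambda>x. pt (k x))"
  let ?C = "count_space UNIV"
  have [measurable]: "(\<lambda>x. pt (k x)) \<in> borel_measurable M"
    by (rule measurable_compose[OF k]) simp
  interpret P: prob_space ?P by (rule prob_space_distr) measurable
  define a where "a i = measure M {x\<in>space M. k x = i}" for i
  define p where "p y = measure ?P {y}" for y
  have ea: "emeasure M {x\<in>space M. k x = i} = ennreal (a i)" for i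
    by (simp add: a_def emeasure_eq_measure)
  have a: "0 \<le> a i" "a i \<le> p (pt i)" for i
    unfolding a_def p_def by (auto simp: measure_distr intro!: finite_measure_mono)
  have p: "0 \<le> p y" "p y \<le> 1" for y
    by (auto simp: p_def)
  have psum: "ennreal (p y) = (\<integral>\<^sup>+i. ennreal (a i) * indicator {pt i} y \<partial>?C)" for y
  proof -
    have "ennreal (p y) = emeasure ?P {y}" by (simp add: p_def P.emeasure_eq_measure)
    also have "\<dots> = (\<integral>\<^sup>+x. indicator {y} (pt (k x)) \<partial>M)"
      by (subst nn_integral_indicator[symmetric], simp, subst nn_integral_distr) auto
    also have "\<dots> = (\<integral>\<^sup>+i. indicator {y} (pt i) * emeasure M {x\<in>space M. k x = i} \<partial>?C)"
      by (rule nn_integral_countable_partition) measurable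
    also have "\<dots> = (\<integral>\<^sup>+i. ennreal (a i) * indicator {pt i} y \<partial>?C)"
      by (intro nn_integral_cong) (auto simp: ea indicator_def)
    finally show ?thesis .
  qed
  \<comment> \<open>The mass of each output value is spread over the indices that produce it, which
    turns sums over all output values into sums over the countable index type.\<close>
  have sum_fibre: "(\<integral>\<^sup>+y. ennreal (p y) * c y \<partial>?C) = (\<integral>\<^sup>+i. ennreal (a i) * c (pt i) \<partial>?C)" for c :: "'b \<Rightarrow> ennreal"
  proof -
    have "(\<integral>\<^sup>+y. ennreal (p y) * c y \<partial>?C) = (\<integral>\<^sup>+y. (\<integral>\<^sup>+i. ennreal (a i) * c y * indicator {pt i} y \<partial>?C) \<partial>?C)"
      unfolding psum by (intro nn_integral_cong, subst nn_integral_multc[symmetric]) (auto simp: ac_simps)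
    also have "\<dots> = (\<integral>\<^sup>+i. (\<integral>\<^sup>+y. ennreal (a i) * c y * indicator {pt i} y \<partial>?C) \<partial>?C)"
      by (rule nn_integral_count_space_swap)
    also have "\<dots> = (\<integral>\<^sup>+i. ennreal (a i) * c (pt i) \<partial>?C)"
      by (intro nn_integral_cong) (simp add: nn_integral_indicator_singleton)
    finally show ?thesis .
  qed
  have a1: "(\<integral>\<^sup>+i. ennreal (a i) \<partial>?C) = 1"
    using nn_integral_countable_partition[OF k, of "\<lambda>_. 1"] by (simp add: ea emeasure_space_1)
  \<comment> \<open>The law is purely atomic, being carried by the countably many points
    \<open>pt i\<close>; this selects the finite branch in the definition of
    \<open>disc_entropy\<close>.\<close>
  have "(\<integral>\<^sup>+y. emeasure ?P {y} \<partial>?C) = 1"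
    using sum_fibre[of "\<lambda>_. 1"] a1 by (simp add: p_def P.emeasure_eq_measure)
  then have "disc_entropy ?P = (\<integral>\<^sup>+y. ennreal (- p y * log 2 (p y)) \<partial>?C)"
    by (simp add: disc_entropy_def p_def)
  also have "\<dots> = (\<integral>\<^sup>+y. ennreal (p y) * code_len (p y) \<partial>?C)"
  proof (intro nn_integral_cong)
    fix y show "ennreal (- p y * log 2 (p y)) = ennreal (p y) * code_len (p y)"
      using p[of y] by (cases "p y = 0") (auto simp: code_len_def ennreal_mult[symmetric])
  qed
  also have "\<dots> = (\<integral>\<^sup>+i. ennreal (a i) * code_len (p (pt i)) \<partial>?C)"
    by (rule sum_fibre)
  finally have "disc_entropy ?P + ennreal (1 / ln 2)
      = (\<integral>\<^sup>+i. ennreal (a i) * code_len (p (pt i)) \<partial>?C) + (\<integral>\<^sup>+i. ennreal (a i) \<partial>?C) * ennreal (1 / ln 2)"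
    by (simp add: a1)
  also have "\<dots> = (\<integral>\<^sup>+i. ennreal (a i) * (code_len (p (pt i)) + ennreal (1 / ln 2)) \<partial>?C)"
    by (simp add: distrib_left nn_integral_add nn_integral_multc)
  also have "\<dots> \<le> (\<integral>\<^sup>+i. ennreal (a i) * code_len (q i) + ennreal (1 / ln 2) * ennreal (q i) \<partial>?C)"
    by (intro nn_integral_mono gibbs_pointwise a p q)
  also have "\<dots> = (\<integral>\<^sup>+i. code_len (q i) * emeasure M {x\<in>space M. k x = i} \<partial>?C)
      + ennreal (1 / ln 2) * (\<integral>\<^sup>+i. q i \<partial>?C)"
    by (simp add: nn_integral_add nn_integral_cmult ea mult.commute[of "ennreal (a _)"])
  also have "(\<integral>\<^sup>+i. code_len (q i) * emeasure M {x\<in>space M. k x = i} \<partial>?C) = (\<integral>\<^sup>+x. code_len (q (k x)) \<partial>M)"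
    by (rule nn_integral_countable_partition[symmetric]) fact
  finally show ?thesis .
qed

section \<open>Weights of the array entries\<close>

text \<open>Rescaling the density \<open>a (1 + t)^-(1+a)\<close> without renormalising makes the total mass \<open>s\<close>,
  so that the masses of the output density \<open>r\<close> add up to \<open>1\<close>.\<close>

definition tail_density :: "real \<Rightarrow> real \<Rightarrow> real \<Rightarrow> real" where
  "tail_density a s t = (if 0 < s \<and> 0 \<le> t then a * (1 + t / s) powr - (1 + a) else 0)"

lemma tail_density_measurable[measurable]:
  assumes [measurable]: "f \<in> borel_measurable M" "g \<in> borel_measurable M"
  shows "(\<lambda>x. tail_density a (f x) (g x)) \<in> borel_measurable M"
  unfolding tail_density_def by measurable

lemma tail_density_bounds:
  assumes "0 < a" "a \<le> 1"
  shows "0 \<le> tail_density a s t" "tail_density a s t \<le> 1"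
proof -
  show "0 \<le> tail_density a s t" using assms by (simp add: tail_density_def)
  have "a * (1 + t / s) powr - (1 + a) \<le> 1 * 1" if "0 < s" "0 \<le> t"
  proof (intro mult_mono)
    have "(1 + t / s) powr - (1 + a) \<le> (1 + t / s) powr 0"
      using that assms by (intro powr_mono) auto
    also have "\<dots> \<le> 1" by simp
    finally show "(1 + t / s) powr - (1 + a) \<le> 1" .
  qed (use assms in auto)
  then show "tail_density a s t \<le> 1" by (auto simp: tail_density_def)
qed

text \<open>A larger height means a longer code, so the accepted height can be replaced by its upper
  bound \<open>W x y\<close>.\<close>

lemma tail_density_antimono:
  assumes "0 < a" "0 < s" "0 \<le> t" "t \<le> t'"
  shows "tail_density a s t' \<le> tail_density a s t"
  using assms by (auto simp: tail_density_def intro!: mult_left_mono powr_mono2' add_left_mono divide_right_mono add_pos_nonneg)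

lemma nn_integral_tail_density:
  assumes "0 < a" "0 \<le> s"
  shows "(\<integral>\<^sup>+t. ennreal (tail_density a s t) * indicator {0..} t \<partial>lborel) = ennreal s"
proof (cases "s = 0")
  case False
  then have s: "0 < s" using assms by simp
  have "(\<integral>\<^sup>+t. ennreal (tail_density a s t) * indicator {0..} t \<partial>lborel) = 0 - (- s * (1 + 0 / s) powr - a)"
  proof (rule nn_integral_FTC_atLeast)
    fix t :: real assume t: "0 \<le> t"
    then have pos: "0 < 1 + t / s" using s by (simp add: add_pos_nonneg)
    show "((\<lambda>t. - s * (1 + t / s) powr - a) has_real_derivative tail_density a s t) (at t)"
    proof -
      have "((\<lambda>t. 1 + t / s) has_real_derivative 1 / s) (at t)"
        using s by (auto intro!: derivative_eq_intros)
      from DERIV_cmult[OF DERIV_fun_powr[OF this pos, of "- a"], of "- s"] show ?thesis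
        using s t by (simp add: tail_density_def minus_diff_commute[of 1])
    qed
  next
    have "((\<lambda>t. (1 + t / s) powr - a) \<longlongrightarrow> 0) at_top"
    proof (rule tendsto_neg_powr)
      show "filterlim (\<lambda>t. 1 + t / s) at_top at_top"
        using filterlim_tendsto_pos_mult_at_top[OF tendsto_const _ filterlim_ident, of "1 / s"] s
        by (intro filterlim_tendsto_add_at_top[OF tendsto_const]) simp
    qed (use assms in simp)
    then have "((\<lambda>t. - s * (1 + t / s) powr - a) \<longlongrightarrow> - s * 0) at_top"
      by (intro tendsto_mult tendsto_const)
    then show "((\<lambda>t. - s * (1 + t / s) powr - a) \<longlongrightarrow> 0) at_top" by simp
  qed (use assms in \<open>auto simp: tail_density_def\<close>)
  then show ?thesis by simp
qed (simp add: tail_density_def)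

context borel_prob_space
begin

text \<open>The weight reads the array and an output density but never the input, so it is a code
  for the index that is available once the array is given.\<close>

definition weight :: "real \<Rightarrow> ('b \<Rightarrow> real) \<Rightarrow> (nat \<Rightarrow> nat \<Rightarrow> 'b \<times> real) \<Rightarrow> nat \<times> nat \<Rightarrow> real" where
  "weight a r \<omega> ij = (case ij of (i, j) \<Rightarrow>
     (1/2) ^ Suc i * tail_density a (r (fst (\<omega> i j))) (real j + snd (\<omega> i j)))"

lemma weight_bounds:
  assumes "0 < a" "a \<le> 1"
  shows "0 \<le> weight a r \<omega> ij" "weight a r \<omega> ij \<le> 1"
proof -
  have "(1/2 :: real) ^ n \<le> 1" for n by (simp add: power_le_one)
  then show "0 \<le> weight a r \<omega> ij" "weight a r \<omega> ij \<le> 1"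
    using tail_density_bounds[OF assms]
    unfolding weight_def by (auto split: prod.split intro!: mult_le_one simp del: power_Suc)
qed

lemma fst_snd_borel_measurable:
  "fst \<in> borel_measurable (borel :: ('b \<times> real) measure)"
  "snd \<in> borel_measurable (borel :: ('b \<times> real) measure)"
  by (subst borel_prod[symmetric], measurable)+

lemma weight_measurable[measurable]:
  assumes [measurable]: "r \<in> borel_measurable borel"
  shows "(\<lambda>\<omega>. weight a r \<omega> ij) \<in> borel_measurable borel"
proof -
  have [measurable]: "(\<lambda>\<omega>. fst (\<omega> i j)) \<in> borel_measurable (borel :: (nat \<Rightarrow> nat \<Rightarrow> 'b \<times> real) measure)"
    "(\<lambda>\<omega>. snd (\<omega> i j)) \<in> borel_measurable (borel :: (nat \<Rightarrow> nat \<Rightarrow> 'b \<times> real) measure)" for i j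
    by (rule measurable_compose[OF component2_borel_measurable], rule fst_snd_borel_measurable)+
  show ?thesis unfolding weight_def by (cases ij) (simp; measurable)
qed

text \<open>Within one row the heights \<open>j + u\<close> tile the half-line, so a row has
  intensity \<open>R\<close> times Lebesgue measure. Integrating the tail density over the height
  leaves \<open>r y\<close>, integrating over \<open>y\<close> leaves 1, and the row factors sum to
  1.\<close>

lemma nn_integral_weight:
  assumes a: "0 < a" "a \<le> 1"
    and r[measurable]: "r \<in> borel_measurable borel" and "\<And>y. 0 \<le> r y"
    and r1: "(\<integral>\<^sup>+y. r y \<partial>R) = 1"
  shows "(\<integral>\<^sup>+\<omega>. (\<integral>\<^sup>+ij. weight a r \<omega> ij \<partial>count_space UNIV) \<partial>array R) = 1"
proof -
  let ?g = "\<lambda>j y u. ennreal (tail_density a (r y) (real j + u))"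
  have comp: "(\<integral>\<^sup>+\<omega>. ?g j (fst (\<omega> i j)) (snd (\<omega> i j)) \<partial>array R)
      = (\<integral>\<^sup>+y. (\<integral>\<^sup>+u. ?g j y u * indicator {0..1} u \<partial>lborel) \<partial>R)" for i j
  proof -
    note fst_snd_borel_measurable[measurable]
    have [measurable]: "(\<lambda>p. ?g j (fst p) (snd p)) \<in> borel_measurable (borel :: ('b \<times> real) measure)"
      by measurable
    have [measurable]: "(\<lambda>\<omega>. \<omega> i j) \<in> borel_measurable (array R)"
      by (subst measurable_cong_sets[OF sets_array refl]) (rule component2_borel_measurable)
    have "(\<integral>\<^sup>+\<omega>. ?g j (fst (\<omega> i j)) (snd (\<omega> i j)) \<partial>array R)
        = (\<integral>\<^sup>+p. ?g j (fst p) (snd p) \<partial>distr (array R) borel (\<lambda>\<omega>. \<omega> i j))"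
      by (subst nn_integral_distr) simp_all
    also have "\<dots> = (\<integral>\<^sup>+y. (\<integral>\<^sup>+u. ?g j y u * indicator {0..1} u \<partial>lborel) \<partial>R)"
      unfolding distr_array_component by (subst nn_integral_proposal) simp_all
    finally show ?thesis .
  qed
  have cells: "(\<Sum>j. \<integral>\<^sup>+u. ?g j y u * indicator {0..1} u \<partial>lborel) = ennreal (r y)" for y
  proof -
    have "(\<integral>\<^sup>+u. ?g j y u * indicator {0..1} u \<partial>lborel)
        = (\<integral>\<^sup>+t. ennreal (tail_density a (r y) t) * indicator {real j..<real (Suc j)} t \<partial>lborel)" for j
    proof -
      have "(\<integral>\<^sup>+t. ennreal (tail_density a (r y) t) * indicator {real j..<real (Suc j)} t \<partial>lborel)
          = (\<integral>\<^sup>+u. ennreal (tail_density a (r y) (real j + u)) * indicator {real j..<real (Suc j)} (real j + u) \<partial>lborel)"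
        using nn_integral_real_affine[of "\<lambda>t. ennreal (tail_density a (r y) t) * indicator {real j..<real (Suc j)} t" 1 "real j"]
        by simp
      \<comment> \<open>The law of \<open>u\<close> lives on the closed interval, whereas the tiles
        must be half-open to be disjoint; the two differ only at \<open>u = 1\<close>.\<close>
      also have "\<dots> = (\<integral>\<^sup>+u. ?g j y u * indicator {0..1} u \<partial>lborel)"
        by (intro nn_integral_cong_AE, rule AE_mp[OF AE_lborel_singleton[of 1]])
           (auto simp: indicator_def)
      finally show ?thesis by simp
    qed
    then have "(\<Sum>j. \<integral>\<^sup>+u. ?g j y u * indicator {0..1} u \<partial>lborel)
        = (\<integral>\<^sup>+t. (\<Sum>j. ennreal (tail_density a (r y) t) * indicator {real j..<real (Suc j)} t) \<partial>lborel)"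
      by (simp only:) (intro nn_integral_suminf[symmetric], measurable)
    also have "\<dots> = (\<integral>\<^sup>+t. ennreal (tail_density a (r y) t) * indicator {0..} t \<partial>lborel)"
    proof (intro nn_integral_cong)
      fix t :: real
      have "(\<Sum>j. indicator {real j..<real (Suc j)} t) = (indicator (\<Union>j. {real j..<real (Suc j)}) t :: ennreal)"
        by (rule suminf_indicator) (auto simp: disjoint_family_on_def)
      also have "(\<Union>j. {real j..<real (Suc j)}) = {0..}"
      proof (intro set_eqI iffI)
        fix x :: real assume "x \<in> {0..}"
        then have "real (nat \<lfloor>x\<rfloor>) \<le> x" "x < real (Suc (nat \<lfloor>x\<rfloor>))" by (auto; linarith)+
        then show "x \<in> (\<Union>j. {real j..<real (Suc j)})" by auto
      qed auto
      finally show "(\<Sum>j. ennreal (tail_density a (r y) t) * indicator {real j..<real (Suc j)} t)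
          = ennreal (tail_density a (r y) t) * indicator {0..} t" by simp
    qed
    also have "\<dots> = ennreal (r y)" using assms by (intro nn_integral_tail_density) auto
    finally show ?thesis .
  qed
  have [measurable]: "(\<lambda>y. \<integral>\<^sup>+u. ?g j y u * indicator {0..1} u \<partial>lborel) \<in> borel_measurable R" for j
    by measurable
  have wm: "(\<lambda>\<omega>. ennreal (weight a r \<omega> (i, j))) \<in> borel_measurable (array R)" for i j
    by (subst measurable_cong_sets[OF sets_array refl])
      (rule measurable_compose[OF weight_measurable[OF r] measurable_ennreal])
  have gm: "(\<lambda>\<omega>. ?g j (fst (\<omega> i j)) (snd (\<omega> i j))) \<in> borel_measurable (array R)" for i j
  proof -
    note fst_snd_borel_measurable[measurable]
    have m: "(\<lambda>p. ?g j (fst p) (snd p)) \<in> borel_measurable (borel :: ('b \<times> real) measure)"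
      by measurable
    have "(\<lambda>\<omega>. \<omega> i j) \<in> borel_measurable (array R)"
      by (subst measurable_cong_sets[OF sets_array refl]) (rule component2_borel_measurable)
    from measurable_compose[OF this m] show ?thesis by simp
  qed
  have "(\<integral>\<^sup>+\<omega>. (\<integral>\<^sup>+ij. weight a r \<omega> ij \<partial>count_space UNIV) \<partial>array R)
      = (\<integral>\<^sup>+\<omega>. (\<Sum>i. \<Sum>j. ennreal (weight a r \<omega> (i, j))) \<partial>array R)"
    by (simp add: nn_integral_fst_count_space[symmetric] nn_integral_count_space_nat)
  also have "\<dots> = (\<Sum>i. \<Sum>j. \<integral>\<^sup>+\<omega>. ennreal (weight a r \<omega> (i, j)) \<partial>array R)"
    using wm by (simp add: nn_integral_suminf)
  also have "\<dots> = (\<Sum>i. \<Sum>j. ennreal ((1/2) ^ Suc i) * (\<integral>\<^sup>+y. (\<integral>\<^sup>+u. ?g j y u * indicator {0..1} u \<partial>lborel) \<partial>R))"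
  proof (intro suminf_cong)
    fix i j
    have "(\<integral>\<^sup>+\<omega>. ennreal (weight a r \<omega> (i, j)) \<partial>array R)
        = (\<integral>\<^sup>+\<omega>. ennreal ((1/2) ^ Suc i) * ?g j (fst (\<omega> i j)) (snd (\<omega> i j)) \<partial>array R)"
      unfolding weight_def using tail_density_bounds[OF a]
      by (intro nn_integral_cong) (simp add: ennreal_mult del: power_Suc)
    also have "\<dots> = ennreal ((1/2) ^ Suc i) * (\<integral>\<^sup>+y. (\<integral>\<^sup>+u. ?g j y u * indicator {0..1} u \<partial>lborel) \<partial>R)"
      using gm by (subst nn_integral_cmult) (simp_all add: comp del: power_Suc)
    finally show "(\<integral>\<^sup>+\<omega>. ennreal (weight a r \<omega> (i, j)) \<partial>array R)
      = ennreal ((1/2) ^ Suc i) * (\<integral>\<^sup>+y. (\<integral>\<^sup>+u. ?g j y u * indicator {0..1} u \<partial>lborel) \<partial>R)" .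
  qed
  also have "\<dots> = (\<Sum>i. ennreal ((1/2) ^ Suc i) * (\<integral>\<^sup>+y. (\<Sum>j. \<integral>\<^sup>+u. ?g j y u * indicator {0..1} u \<partial>lborel) \<partial>R))"
    by (simp add: nn_integral_suminf del: power_Suc)
  also have "\<dots> = 1"
    using suminf_half by (simp add: cells r1 del: power_Suc)
  finally show ?thesis .
qed

end

section \<open>Information density\<close>

text \<open>From \<open>ln t \<le> t - 1\<close> at \<open>t = (1 + 1 / v) / 2\<close>. For the
  information density \<open>v\<close> the mean of \<open>1 / v\<close> is at most 1, so the last
  term has mean at most 0 and the replacement of \<open>1 + v\<close> by \<open>v\<close> costs one
  bit on average.\<close>

lemma log2_one_plus_le:
  fixes v :: real
  assumes "0 < v"
  shows "log 2 (1 + v) \<le> log 2 v + 1 + (1 / v - 1) / (2 * ln 2)"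
proof -
  have "ln ((1 + 1 / v) / 2) \<le> (1 + 1 / v) / 2 - 1"
    using assms by (intro ln_le_minus_one) (auto intro!: add_pos_pos)
  moreover have "ln ((1 + 1 / v) / 2) = ln (1 + v) - ln v - ln 2"
  proof -
    have "(1 + 1 / v) / 2 = (1 + v) / (v * 2)" using assms by (simp add: field_simps)
    also have "ln \<dots> = ln (1 + v) - (ln v + ln 2)"
      using assms by (subst ln_div) (auto simp: ln_mult)
    finally show ?thesis by simp
  qed
  ultimately have "ln (1 + v) \<le> ln v + ln 2 + (1 / v - 1) / 2" by (simp add: field_simps)
  then have "ln (1 + v) / ln 2 \<le> (ln v + ln 2 + (1 / v - 1) / 2) / ln 2"
    by (intro divide_right_mono) auto
  then show ?thesis by (simp add: log_def add_divide_distrib)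
qed

text \<open>Integrated, with the mean of \<open>1 / v\<close> at most 1, this yields that mutual
  information is nonnegative.\<close>

lemma log2_ge:
  fixes v :: real
  assumes "0 < v"
  shows "(1 - 1 / v) / ln 2 \<le> log 2 v"
proof -
  have "ln (1 / v) \<le> 1 / v - 1" using assms by (intro ln_le_minus_one) auto
  then have "1 - 1 / v \<le> ln v" using assms by (simp add: ln_div)
  then show ?thesis unfolding log_def by (intro divide_right_mono) auto
qed

text \<open>With \<open>D\<close> the density of \<open>P\<close> relative to
  \<open>\<mu> \<Otimes>\<^sub>M R\<close> and \<open>r\<close> that of the output law relative to
  \<open>R\<close>, the quotient \<open>D / r\<close> is the density of \<open>P\<close> relative to
  the product of its marginals. The mutual information is the mean of its logarithm, and the
  pointwise logarithm bounds give the rest.\<close>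

lemma information_bounds:
  fixes P :: "('a::second_countable_topology \<times> 'b::second_countable_topology) measure"
    and D :: "'a \<Rightarrow> 'b \<Rightarrow> real" and r :: "'b \<Rightarrow> real"
  assumes P: "prob_space P" and R: "prob_space R" "sets R = sets borel" and \<mu>: "prob_space \<mu>"
    and D[measurable]: "(\<lambda>(x, y). D x y) \<in> borel_measurable (borel \<Otimes>\<^sub>M borel)" and D0: "\<And>x y. 0 \<le> D x y"
    and r[measurable]: "r \<in> borel_measurable borel" and r0: "\<And>y. 0 \<le> r y"
    and P_eq: "P = density (\<mu> \<Otimes>\<^sub>M R) (\<lambda>(x, y). ennreal (D x y))"
    and fst_P: "distr P borel fst = \<mu>" and snd_P: "distr P borel snd = density R r"
    and fin: "mutual_info P < \<infinity>"
  obtains I where "mutual_info P = ereal I" "0 \<le> I"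
    "AE p in P. 0 < r (snd p)"
    "(\<integral>\<^sup>+p. log 2 (1 + D (fst p) (snd p) / r (snd p)) \<partial>P) \<le> ennreal (I + 1)"
proof -
  interpret P: prob_space P by fact
  interpret R: prob_space R by fact
  interpret M: prob_space \<mu> by fact
  interpret MR: pair_prob_space \<mu> R ..
  have sR[measurable_cong]: "sets R = sets borel" by fact
  have sM[measurable_cong]: "sets \<mu> = sets borel" using fst_P[symmetric] by simp
  have sP[measurable_cong]: "sets P = sets (borel \<Otimes>\<^sub>M borel)"
    unfolding P_eq by (simp add: sR sM cong: sets_pair_measure_cong)
  define PY where "PY = density R r"
  define T where "T = \<mu> \<Otimes>\<^sub>M PY"
  interpret PY: prob_space PY
    unfolding PY_def snd_P[symmetric] by (intro P.prob_space_distr) measurable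
  interpret T: pair_prob_space \<mu> PY ..
  have T_eq: "T = density (\<mu> \<Otimes>\<^sub>M R) (\<lambda>p. r (snd p))"
  proof -
    have "T = density \<mu> (\<lambda>_. 1) \<Otimes>\<^sub>M density R r"
      by (simp add: T_def PY_def density_1)
    also have "\<dots> = density (\<mu> \<Otimes>\<^sub>M R) (\<lambda>(x, y). 1 * ennreal (r y))"
      by (intro pair_measure_density)
         (auto simp: PY_def[symmetric] R.sigma_finite_measure_axioms PY.sigma_finite_measure_axioms)
    finally show ?thesis by (simp add: case_prod_beta')
  qed
  have D2[measurable]: "(\<lambda>p. D (fst p) (snd p)) \<in> borel_measurable (borel \<Otimes>\<^sub>M borel)"
    using D by (simp add: case_prod_beta')
  \<comment> \<open>Division by zero sets \<open>v\<close> to 0 where \<open>r\<close> vanishes;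
    such points form a null set for \<open>P\<close> by \<open>r_pos\<close>.\<close>
  define v where "v p = D (fst p) (snd p) / r (snd p)" for p
  have v[measurable]: "v \<in> borel_measurable (borel \<Otimes>\<^sub>M borel)"
    unfolding v_def[abs_def] by measurable
  have v0: "0 \<le> v p" for p by (simp add: v_def D0 r0)
  have sT[measurable_cong]: "sets T = sets (borel \<Otimes>\<^sub>M borel)"
    unfolding T_eq by (simp add: sR sM cong: sets_pair_measure_cong)
  have r_pos: "AE p in P. 0 < r (snd p)"
  proof -
    have "AE y in density R r. 0 < r y"
      by (subst AE_density) (auto simp: sR)
    then have "AE y in distr P borel snd. 0 < r y" unfolding snd_P .
    then show ?thesis by (subst (asm) AE_distr_iff) auto
  qed
  have P_T: "density T v = P"
  proof -
    have "density T v = density (\<mu> \<Otimes>\<^sub>M R) (\<lambda>p. ennreal (r (snd p)) * ennreal (v p))"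
      unfolding T_eq by (intro density_density_eq) measurable
    also have "\<dots> = P"
    proof (subst P_eq, rule density_cong)
      show "(\<lambda>p. ennreal (r (snd p)) * ennreal (v p)) \<in> borel_measurable (\<mu> \<Otimes>\<^sub>M R)"
        by measurable
      show "(\<lambda>(x, y). ennreal (D x y)) \<in> borel_measurable (\<mu> \<Otimes>\<^sub>M R)"
        by measurable
      have "AE p in density (\<mu> \<Otimes>\<^sub>M R) (\<lambda>(x, y). ennreal (D x y)). 0 < r (snd p)"
        using r_pos unfolding P_eq .
      then have "AE p in \<mu> \<Otimes>\<^sub>M R. 0 < D (fst p) (snd p) \<longrightarrow> 0 < r (snd p)"
        by (subst (asm) AE_density) (auto simp: case_prod_beta')
      then show "AE p in \<mu> \<Otimes>\<^sub>M R. ennreal (r (snd p)) * ennreal (v p) = (case p of (x, y) \<Rightarrow> ennreal (D x y))"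
      proof eventually_elim
        case (elim p)
        then show ?case
          using D0[of "fst p" "snd p"] r0[of "snd p"]
          by (cases "r (snd p) = 0") (auto simp: v_def case_prod_beta' ennreal_mult[symmetric] order.order_iff_strict)
      qed
    qed
    finally show ?thesis .
  qed
  have v_pos: "AE p in P. 0 < v p"
    unfolding P_T[symmetric] by (subst AE_density) auto
  \<comment> \<open>Uniqueness of the derivative identifies \<open>v\<close> with
    \<open>RN_deriv T P\<close> up to a \<open>T\<close>-null set, and absolute continuity makes
    that set null for \<open>P\<close> as well.\<close>
  have ent: "AE p in P. entropy_density 2 T P p = log 2 (v p)"
  proof -
    have "AE p in T. ennreal (v p) = RN_deriv T P p"
      using P_T T.sigma_finite_measure_axioms unfolding T_def
      by (intro sigma_finite_measure.RN_deriv_unique) (auto simp: T_def[symmetric])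
    moreover have "absolutely_continuous T P"
      unfolding P_T[symmetric] by (intro absolutely_continuousI_density) measurable
    ultimately have "AE p in P. ennreal (v p) = RN_deriv T P p"
      by (intro absolutely_continuous_AE[of P T]) (auto simp: sP sT)
    then show ?thesis
    proof eventually_elim
      case (elim p)
      have "enn2real (RN_deriv T P p) = v p" unfolding elim[symmetric] using v0 by simp
      then show ?case by (simp add: entropy_density_def)
    qed
  qed
  have T_def': "distr P borel fst \<Otimes>\<^sub>M distr P borel snd = T"
    by (simp add: fst_P snd_P T_def PY_def)
  from fin have int: "integrable P (entropy_density 2 T P)"
    and mi: "mutual_info P = ereal (P.mutual_information 2 borel borel fst snd)"
    unfolding mutual_info_def Let_def T_def' by (auto split: if_splits)
  have ent_m: "entropy_density 2 T P \<in> borel_measurable P"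
    using int by auto
  have logm: "(\<lambda>p. log 2 (v p)) \<in> borel_measurable P" by measurable
  have logv: "integrable P (\<lambda>p. log 2 (v p))"
    by (rule integrable_cong_AE[THEN iffD1, OF ent_m logm ent int])
  have I_eq: "P.mutual_information 2 borel borel fst snd = (\<integral>p. log 2 (v p) \<partial>P)"
  proof -
    have "distr P (borel \<Otimes>\<^sub>M borel) (\<lambda>x. (fst x, snd x)) = P"
      using distr_id2[OF sP[symmetric]] by simp
    then show ?thesis
      unfolding P.mutual_information_def KL_divergence_def T_def'
      using integral_cong_AE[OF ent_m logm ent] by simp
  qed
  \<comment> \<open>Since \<open>P\<close> has density \<open>v\<close> with respect to
    \<open>T\<close>, the integral is the \<open>T\<close>-mass of the set where \<open>v\<close> is
    positive. The inequality fixes the sign of the correction terms in \<open>log2_ge\<close> and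
    \<open>log2_one_plus_le\<close>.\<close>
  have inv: "(\<integral>\<^sup>+p. ennreal (1 / v p) \<partial>P) \<le> 1"
  proof -
    have "(\<integral>\<^sup>+p. ennreal (1 / v p) \<partial>P) = (\<integral>\<^sup>+p. ennreal (v p) * ennreal (1 / v p) \<partial>T)"
      unfolding P_T[symmetric] by (subst nn_integral_density) auto
    also have "\<dots> \<le> (\<integral>\<^sup>+p. 1 \<partial>T)"
      using v0 by (intro nn_integral_mono) (simp add: ennreal_mult[symmetric] ennreal_le_1)
    also have "\<dots> = 1" unfolding T_def by (simp add: T.emeasure_space_1)
    finally show ?thesis .
  qed
  have inv_int: "integrable P (\<lambda>p. 1 / v p)"
    using inv v0 by (intro integrableI_nonneg) (auto simp: le_less_trans)
  have inv_le: "(\<integral>p. 1 / v p \<partial>P) \<le> 1"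
  proof -
    have "ennreal (\<integral>p. 1 / v p \<partial>P) = (\<integral>\<^sup>+p. ennreal (1 / v p) \<partial>P)"
      using v0 by (intro nn_integral_eq_integral[symmetric] inv_int) auto
    then have "ennreal (\<integral>p. 1 / v p \<partial>P) \<le> 1" using inv by (simp only:)
    then show ?thesis by (simp only: ennreal_le_1)
  qed
  let ?I = "\<integral>p. log 2 (v p) \<partial>P"
  have "0 \<le> (1 - (\<integral>p. 1 / v p \<partial>P)) / ln 2" using inv_le by simp
  also have "\<dots> = (\<integral>p. (1 - 1 / v p) / ln 2 \<partial>P)"
    using inv_int by (simp add: P.prob_space)
  also have "\<dots> \<le> ?I"
    using v_pos log2_ge inv_int logv by (intro integral_mono_AE) auto
  finally have I0: "0 \<le> ?I" .
  let ?U = "\<lambda>p. log 2 (v p) + 1 + (1 / v p - 1) / (2 * ln 2)"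
  have U_int: "integrable P ?U" using logv inv_int by auto
  have U: "AE p in P. log 2 (1 + v p) \<le> ?U p"
    using v_pos by eventually_elim (rule log2_one_plus_le)
  have "(\<integral>\<^sup>+p. log 2 (1 + v p) \<partial>P) \<le> (\<integral>\<^sup>+p. ?U p \<partial>P)"
    using U by (intro nn_integral_mono_AE) (auto intro: ennreal_leI)
  also have "\<dots> = ennreal (\<integral>p. ?U p \<partial>P)"
  proof (intro nn_integral_eq_integral U_int)
    show "AE p in P. 0 \<le> ?U p"
      using U
    proof eventually_elim
      case (elim p)
      have "0 \<le> log 2 (1 + v p)" using v0[of p] by simp
      with elim show ?case by (rule order_trans[rotated])
    qed
  qed
  also have "(\<integral>p. ?U p \<partial>P) = ?I + 1 + ((\<integral>p. 1 / v p \<partial>P) - 1) / (2 * ln 2)"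
    using logv inv_int by (simp add: P.prob_space)
  also have "ennreal \<dots> \<le> ennreal (?I + 1)"
    using inv_le by (intro ennreal_leI) (simp add: divide_le_0_iff)
  finally have "(\<integral>\<^sup>+p. log 2 (1 + v p) \<partial>P) \<le> ennreal (?I + 1)" .
  then show thesis
    using that[of ?I] mi I_eq I0 r_pos by (simp add: v_def)
qed

section \<open>Entropy of the output given the array\<close>

lemma code_len_antimono: "p \<le> q \<Longrightarrow> code_len q \<le> code_len p"
  by (auto simp: code_len_def intro!: ennreal_leI)

lemma code_len_tail_density:
  assumes "0 < a" "a \<le> 1" "0 < s" "0 \<le> t"
  shows "code_len (tail_density a s t) = ennreal (- log 2 a) + ennreal (1 + a) * ennreal (log 2 (1 + t / s))"
proof -
  have p: "0 < 1 + t / s" "0 \<le> log 2 (1 + t / s)" using assms by (auto simp: add_pos_nonneg)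
  have "- log 2 (tail_density a s t) = - log 2 a + (1 + a) * log 2 (1 + t / s)"
    using assms p by (simp add: tail_density_def log_mult log_powr algebra_simps)
  moreover have "0 < tail_density a s t" using assms p by (simp add: tail_density_def)
  ultimately show ?thesis
    using assms p by (simp add: code_len_def ennreal_mult[symmetric] ennreal_plus[symmetric] del: ennreal_plus)
qed

lemma code_len_half_power:
  "q \<le> 1 \<Longrightarrow> code_len ((1/2) ^ n * q) = of_nat n + code_len q"
proof -
  assume "q \<le> 1"
  then have "code_len ((1/2) ^ n * q) = ennreal (- log 2 ((1/2) ^ n)) + code_len q"
    by (intro code_len_mult) (auto simp: power_le_one)
  also have "- log 2 ((1/2 :: real) ^ n) = real n"
    by (simp add: log_nat_power log_divide)
  finally show ?thesis by (simp add: ennreal_of_nat_eq_real_of_nat)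
qed

text \<open>Normalisation is demanded for every \<open>x\<close>, not only for almost every one, so
  that each input is an instance of \<open>sampler\<close>; \<open>coupling_exists\<close> repairs
  the exceptional inputs.\<close>

locale coupling = borel_prob_space R for R :: "'b::polish_space measure" +
  fixes W :: "'a::polish_space \<Rightarrow> 'b \<Rightarrow> real"
  assumes W_measurable: "(\<lambda>(x, y). W x y) \<in> borel_measurable (borel \<Otimes>\<^sub>M borel)"
    and W_nonneg: "0 \<le> W x y"
    and W_integral: "(\<integral>\<^sup>+y. W x y \<partial>R) = 1"
begin

lemma W_section[measurable]: "W x \<in> borel_measurable borel"
  using measurable_compose[OF measurable_Pair[OF measurable_const measurable_ident] W_measurable] by simp

sublocale S: sampler R "W x" for x
  by unfold_locales (auto simp: W_nonneg W_integral)

definition index_len :: "real \<Rightarrow> ('b \<Rightarrow> real) \<Rightarrow> 'a \<Rightarrow> (nat \<Rightarrow> nat \<Rightarrow> 'b \<times> real) \<Rightarrow> ennreal" where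
  "index_len a r x \<omega> = code_len (weight a r \<omega> (hit_row R (W x) \<omega>, hit_col R (W x) \<omega>))"

lemma index_measurable:
  "(\<lambda>(x, \<omega>). (hit_row R (W x) \<omega>, hit_col R (W x) \<omega>)) \<in> measurable (borel \<Otimes>\<^sub>M borel) (count_space UNIV)"
proof -
  have "(\<lambda>z. (hit_row R (W (fst z)) (snd z), hit_col R (W (fst z)) (snd z)))
      \<in> measurable (borel \<Otimes>\<^sub>M borel) (count_space UNIV \<Otimes>\<^sub>M count_space UNIV)"
    using row_measurable[OF W_measurable] col_measurable[OF W_measurable]
    by (intro measurable_Pair) (simp_all add: case_prod_beta')
  then show ?thesis
    by (simp add: case_prod_beta' pair_measure_countable)
qed

lemma index_len_measurable:
  assumes r: "r \<in> borel_measurable borel"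
  shows "(\<lambda>(x, \<omega>). index_len a r x \<omega>) \<in> borel_measurable (borel \<Otimes>\<^sub>M borel)"
proof -
  have "(\<lambda>z. code_len (weight a r (snd z) ij)) \<in> borel_measurable (borel \<Otimes>\<^sub>M borel)" for ij
    using measurable_compose[OF measurable_compose[OF measurable_snd weight_measurable[OF r]] code_len_measurable] .
  from measurable_compose_countable[OF this index_measurable] show ?thesis
    by (simp add: index_len_def case_prod_beta')
qed

text \<open>The logarithm splits the length into a row part, of mean 2, and a height part. The
  accepted height lies below \<open>W x\<close> at the output, which bounds the height part by a
  function of the output alone, and the law of the output is known from
  \<open>S.distr_pick\<close>.\<close>

lemma nn_integral_index_len_le:
  assumes a: "0 < a" "a \<le> 1" and r[measurable]: "r \<in> borel_measurable borel"
  shows "(\<integral>\<^sup>+\<omega>. index_len a r x \<omega> \<partial>array R) \<le> 2 + (\<integral>\<^sup>+y. W x y * code_len (tail_density a (r y) (W x y)) \<partial>R)"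
proof -
  let ?h = "\<lambda>y. code_len (tail_density a (r y) (W x y))"
  have [measurable]: "?h \<in> borel_measurable borel" by measurable
  have [measurable]: "hit_row R (W x) \<in> measurable (array R) (count_space UNIV)"
    "pick R (W x) \<in> borel_measurable (array R)"
    using S.row_borel_measurable S.pick_borel_measurable by (simp_all cong: measurable_cong_sets)
  have "AE \<omega> in array R. index_len a r x \<omega> \<le> of_nat (Suc (hit_row R (W x) \<omega>)) + ?h (pick R (W x) \<omega>)"
    using S.AE_pick
  proof eventually_elim
    fix \<omega>
    let ?t = "real (hit_col R (W x) \<omega>) + snd (\<omega> (hit_row R (W x) \<omega>) (hit_col R (W x) \<omega>))"
    let ?y = "pick R (W x) \<omega>"
    assume h: "0 \<le> snd (\<omega> (hit_row R (W x) \<omega>) (hit_col R (W x) \<omega>)) \<and> ?t < W x ?y"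
    have "index_len a r x \<omega> = of_nat (Suc (hit_row R (W x) \<omega>)) + code_len (tail_density a (r ?y) ?t)"
      unfolding index_len_def weight_def using tail_density_bounds[OF a]
      by (simp add: pick_def code_len_half_power del: power_Suc of_nat_Suc)
    \<comment> \<open>If \<open>r\<close> is not positive at the output, the tail density is 0 on
      both sides and both lengths are infinite.\<close>
    also have "code_len (tail_density a (r ?y) ?t) \<le> ?h ?y"
    proof (cases "0 < r ?y")
      case True
      then show ?thesis using h a by (intro code_len_antimono tail_density_antimono) auto
    qed (simp add: tail_density_def)
    finally show "index_len a r x \<omega> \<le> of_nat (Suc (hit_row R (W x) \<omega>)) + ?h ?y"
      by (simp add: add_left_mono del: of_nat_Suc)
  qed
  then have "(\<integral>\<^sup>+\<omega>. index_len a r x \<omega> \<partial>array R)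
      \<le> (\<integral>\<^sup>+\<omega>. of_nat (Suc (hit_row R (W x) \<omega>)) + ?h (pick R (W x) \<omega>) \<partial>array R)"
    by (rule nn_integral_mono_AE)
  also have "\<dots> = 2 + (\<integral>\<^sup>+\<omega>. ?h (pick R (W x) \<omega>) \<partial>array R)"
    by (subst nn_integral_add) (simp_all add: S.nn_integral_Suc_row del: of_nat_Suc)
  also have "(\<integral>\<^sup>+\<omega>. ?h (pick R (W x) \<omega>) \<partial>array R) = (\<integral>\<^sup>+y. ?h y \<partial>distr (array R) borel (pick R (W x)))"
    by (rule nn_integral_distr[symmetric]) measurable
  also have "\<dots> = (\<integral>\<^sup>+y. W x y * ?h y \<partial>R)"
    unfolding S.distr_pick by (rule nn_integral_density) measurable
  finally show ?thesis .
qed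

text \<open>Measurability of the entropy in \<open>\<omega>\<close> is never established; a measurable
  majorant is enough.\<close>

lemma disc_entropy_majorant_index_len:
  assumes a: "0 < a" "a \<le> 1"
    and r[measurable]: "r \<in> borel_measurable borel" and r0: "\<And>y. 0 \<le> r y" and r1: "(\<integral>\<^sup>+y. r y \<partial>R) = 1"
    and \<mu>: "prob_space \<mu>" and s\<mu>[measurable_cong]: "sets \<mu> = sets borel"
  obtains G where "G \<in> borel_measurable borel"
    "\<And>\<omega>. disc_entropy (distr \<mu> borel (\<lambda>x. pick R (W x) \<omega>)) \<le> G \<omega>"
    "(\<integral>\<^sup>+\<omega>. G \<omega> \<partial>array R) = (\<integral>\<^sup>+x. (\<integral>\<^sup>+\<omega>. index_len a r x \<omega> \<partial>array R) \<partial>\<mu>)"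
proof -
  interpret M: prob_space \<mu> by fact
  interpret A: prob_space "array R" by (rule prob_space_array)
  interpret MA: pair_prob_space \<mu> "array R" ..
  note index_len_measurable[OF r, of a, measurable]
  let ?c = "ennreal (1 / ln 2)"
  let ?w = "\<lambda>\<omega>. \<integral>\<^sup>+ij. weight a r \<omega> ij \<partial>count_space UNIV"
  let ?b = "\<lambda>\<omega>. (\<integral>\<^sup>+x. index_len a r x \<omega> \<partial>\<mu>) + ?c * ?w \<omega>"
  have cm: "(\<lambda>(x, \<omega>). index_len a r x \<omega>) \<in> borel_measurable (\<mu> \<Otimes>\<^sub>M array R)"
    using index_len_measurable[OF r, of a] by (simp cong: measurable_cong_sets sets_pair_measure_cong add: s\<mu>)
  have cm2[measurable]: "(\<lambda>\<omega>. \<integral>\<^sup>+x. index_len a r x \<omega> \<partial>\<mu>) \<in> borel_measurable (array R)"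
    using M.borel_measurable_nn_integral[of "\<lambda>\<omega> x. index_len a r x \<omega>" "array R"] measurable_pair_swap[OF cm]
    by simp
  have wm[measurable]: "?w \<in> borel_measurable (array R)"
  proof -
    have "(\<lambda>\<omega>. ennreal (weight a r \<omega> ij)) \<in> borel_measurable (array R)" for ij
      by (subst measurable_cong_sets[OF sets_array refl])
        (rule measurable_compose[OF weight_measurable[OF r] measurable_ennreal])
    then show ?thesis
      by (simp add: nn_integral_fst_count_space[symmetric] nn_integral_count_space_nat)
  qed
  \<comment> \<open>With the array fixed, the weights are plain numbers and the index is random only
    through the input.\<close>
  have H: "disc_entropy (distr \<mu> borel (\<lambda>x. pick R (W x) \<omega>)) + ?c \<le> ?b \<omega>" for \<omega>
  proof -
    have k: "(\<lambda>x. (hit_row R (W x) \<omega>, hit_col R (W x) \<omega>)) \<in> measurable \<mu> (count_space UNIV)"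
      using measurable_compose[OF measurable_Pair[OF measurable_ident measurable_const[of \<omega>]] index_measurable]
      by (simp cong: measurable_cong_sets add: s\<mu>)
    show ?thesis
      using disc_entropy_le_code_len[OF \<mu> k, of "weight a r \<omega>" "\<lambda>(i, j). fst (\<omega> i j)"]
        weight_bounds[OF a] unfolding index_len_def by (simp add: pick_def)
  qed
  \<comment> \<open>The right-hand side is the majorant. The weights have mean total 1, so
    integration over the array turns their term into the same finite constant, and the subtraction
    cancels it exactly.\<close>
  have le: "disc_entropy (distr \<mu> borel (\<lambda>x. pick R (W x) \<omega>)) \<le> ?b \<omega> - ?c" for \<omega>
    using ennreal_minus_mono[OF H[of \<omega>] order_refl[of ?c]] by (simp add: ennreal_add_diff_cancel_right)
  have "(\<lambda>\<omega>. ?b \<omega> - ?c) \<in> borel_measurable (array R)" by measurable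
  then have m: "(\<lambda>\<omega>. ?b \<omega> - ?c) \<in> borel_measurable borel"
    by (subst (asm) measurable_cong_sets[OF sets_array refl])
  have "(\<integral>\<^sup>+\<omega>. ?b \<omega> - ?c \<partial>array R) = (\<integral>\<^sup>+\<omega>. ?b \<omega> \<partial>array R) - (\<integral>\<^sup>+\<omega>. ?c \<partial>array R)"
  proof (intro nn_integral_diff)
    show "AE \<omega> in array R. ?c \<le> ?b \<omega>"
      using H by (intro AE_I2) (meson add_increasing order_trans order_refl zero_le)
    show "(\<integral>\<^sup>+\<omega>. ?c \<partial>array R) \<noteq> \<infinity>" by (simp add: A.emeasure_space_1[simplified])
  qed measurable
  also have "(\<integral>\<^sup>+\<omega>. ?b \<omega> \<partial>array R) = (\<integral>\<^sup>+\<omega>. (\<integral>\<^sup>+x. index_len a r x \<omega> \<partial>\<mu>) \<partial>array R) + ?c"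
    by (simp add: nn_integral_add nn_integral_cmult nn_integral_weight[OF a r r0 r1])
  also have "(\<integral>\<^sup>+\<omega>. ?c \<partial>array R) = ?c" by (simp add: A.emeasure_space_1[simplified])
  also have "(\<integral>\<^sup>+\<omega>. (\<integral>\<^sup>+x. index_len a r x \<omega> \<partial>\<mu>) \<partial>array R) + ?c - ?c = (\<integral>\<^sup>+\<omega>. (\<integral>\<^sup>+x. index_len a r x \<omega> \<partial>\<mu>) \<partial>array R)"
    by (simp add: ennreal_add_diff_cancel_right)
  also have "\<dots> = (\<integral>\<^sup>+x. (\<integral>\<^sup>+\<omega>. index_len a r x \<omega> \<partial>array R) \<partial>\<mu>)"
    using MA.Fubini'[OF cm] by simp
  finally show thesis
    using that[OF m le] by simp
qed

text \<open>Averaging over the input turns the weighted integrals over \<open>R\<close> into an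
  integral over the joint law \<open>P\<close>, where the tail density costs
  \<open>- log 2 a\<close> plus \<open>1 + a\<close> times the logarithm bounded in
  \<open>le\<close>. The number \<open>I\<close> is only an upper bound here, and \<open>a\<close>
  is still free.\<close>

lemma disc_entropy_majorant:
  assumes a: "0 < a" "a \<le> 1" and I: "0 \<le> I"
    and r[measurable]: "r \<in> borel_measurable borel" and r0: "\<And>y. 0 \<le> r y" and r1: "(\<integral>\<^sup>+y. r y \<partial>R) = 1"
    and \<mu>: "prob_space \<mu>" and s\<mu>[measurable_cong]: "sets \<mu> = sets borel"
    and P: "prob_space P" "P = density (\<mu> \<Otimes>\<^sub>M R) (\<lambda>(x, y). ennreal (W x y))"
    and r_pos: "AE p in P. 0 < r (snd p)"
    and le: "(\<integral>\<^sup>+p. log 2 (1 + W (fst p) (snd p) / r (snd p)) \<partial>P) \<le> ennreal (I + 1)"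
  obtains G where "G \<in> borel_measurable borel"
    "\<And>\<omega>. disc_entropy (distr \<mu> borel (\<lambda>x. pick R (W x) \<omega>)) \<le> G \<omega>"
    "(\<integral>\<^sup>+\<omega>. G \<omega> \<partial>array R) \<le> ennreal (2 - log 2 a + (1 + a) * (I + 1))"
proof -
  interpret M: prob_space \<mu> by fact
  interpret MR: pair_prob_space \<mu> R ..
  interpret P: prob_space P by fact
  have W2[measurable]: "(\<lambda>p. W (fst p) (snd p)) \<in> borel_measurable (\<mu> \<Otimes>\<^sub>M R)"
    using W_measurable by (simp add: case_prod_beta' s\<mu> cong: measurable_cong_sets sets_pair_measure_cong)
  have sP[measurable_cong]: "sets P = sets (\<mu> \<Otimes>\<^sub>M R)" by (simp add: P(2))
  let ?h = "\<lambda>p. code_len (tail_density a (r (snd p)) (W (fst p) (snd p)))"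
  obtain G where G: "G \<in> borel_measurable borel"
    "\<And>\<omega>. disc_entropy (distr \<mu> borel (\<lambda>x. pick R (W x) \<omega>)) \<le> G \<omega>"
    "(\<integral>\<^sup>+\<omega>. G \<omega> \<partial>array R) = (\<integral>\<^sup>+x. (\<integral>\<^sup>+\<omega>. index_len a r x \<omega> \<partial>array R) \<partial>\<mu>)"
    using disc_entropy_majorant_index_len[OF a r r0 r1 \<mu> s\<mu>] by blast
  note G(3)
  also have "\<dots> \<le> (\<integral>\<^sup>+x. 2 + (\<integral>\<^sup>+y. W x y * ?h (x, y) \<partial>R) \<partial>\<mu>)"
    using nn_integral_index_len_le[OF a r] by (intro nn_integral_mono) simp
  also have "\<dots> = 2 + (\<integral>\<^sup>+x. (\<integral>\<^sup>+y. W x y * ?h (x, y) \<partial>R) \<partial>\<mu>)"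
  proof (subst nn_integral_add)
    have "(\<lambda>p. ennreal (W (fst p) (snd p)) * ?h p) \<in> borel_measurable (\<mu> \<Otimes>\<^sub>M R)" by measurable
    from borel_measurable_nn_integral_fst[OF this]
    show "(\<lambda>x. \<integral>\<^sup>+y. W x y * ?h (x, y) \<partial>R) \<in> borel_measurable \<mu>" by simp
  qed (simp_all add: M.emeasure_space_1)
  also have "(\<integral>\<^sup>+x. (\<integral>\<^sup>+y. W x y * ?h (x, y) \<partial>R) \<partial>\<mu>) = (\<integral>\<^sup>+p. ennreal (W (fst p) (snd p)) * ?h p \<partial>(\<mu> \<Otimes>\<^sub>M R))"
    by (subst nn_integral_fst[symmetric]) (simp_all, measurable)
  also have "\<dots> = (\<integral>\<^sup>+p. ?h p \<partial>P)"
    unfolding P(2) by (subst nn_integral_density) (simp_all add: case_prod_beta')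
  also have "\<dots> = (\<integral>\<^sup>+p. ennreal (- log 2 a) + ennreal (1 + a) * ennreal (log 2 (1 + W (fst p) (snd p) / r (snd p))) \<partial>P)"
    using r_pos by (intro nn_integral_cong_AE, eventually_elim) (intro code_len_tail_density a W_nonneg)
  also have "\<dots> = ennreal (- log 2 a) + ennreal (1 + a) * (\<integral>\<^sup>+p. log 2 (1 + W (fst p) (snd p) / r (snd p)) \<partial>P)"
    by (subst nn_integral_add) (simp_all add: nn_integral_cmult P.emeasure_space_1)
  also have "2 + \<dots> \<le> 2 + (ennreal (- log 2 a) + ennreal (1 + a) * ennreal (I + 1))"
    using le by (intro add_left_mono mult_left_mono) auto
  also have "\<dots> = ennreal (2 + (- log 2 a + (1 + a) * (I + 1)))"
  proof -
    have "0 \<le> - log 2 a" "0 \<le> (1 + a) * (I + 1)" using a I by auto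
    then have "ennreal (2 + (- log 2 a + (1 + a) * (I + 1)))
        = ennreal 2 + (ennreal (- log 2 a) + ennreal ((1 + a) * (I + 1)))"
      by (simp only: ennreal_plus add_nonneg_nonneg zero_le_numeral)
    also have "ennreal ((1 + a) * (I + 1)) = ennreal (1 + a) * ennreal (I + 1)"
      using a I by (intro ennreal_mult) auto
    finally show ?thesis by (simp only: ennreal_numeral)
  qed
  finally show thesis using that[OF G(1,2)] by (simp add: algebra_simps)
qed

end

section \<open>Kernels and joint laws\<close>

lemma stoch_kernel_measurable:
  assumes "stoch_kernel Q"
  shows "Q \<in> measurable borel (subprob_algebra borel)"
  using assms unfolding stoch_kernel_def borel_prob_def
  by (intro measurable_subprob_algebra) (auto intro: prob_space_imp_subprob_space)

text \<open>The map \<open>h\<close> allows for two readings: the identity gives the joint law of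
  input and output, and the exchange of coordinates gives the disintegration used in
  \<open>cond_entropy\<close>.\<close>

lemma
  fixes Q :: "'a::topological_space \<Rightarrow> 'b::topological_space measure"
  assumes \<mu>: "borel_prob \<mu>" and Q: "stoch_kernel Q"
    and h[measurable]: "h \<in> measurable (borel \<Otimes>\<^sub>M borel) N"
  defines "J \<equiv> \<mu> \<bind> (\<lambda>x. distr (Q x) N (\<lambda>y. h (x, y)))"
  shows sets_bind_distr: "sets J = sets N"
    and nn_integral_bind_distr:
      "f \<in> borel_measurable N \<Longrightarrow> (\<integral>\<^sup>+p. f p \<partial>J) = (\<integral>\<^sup>+x. (\<integral>\<^sup>+y. f (h (x, y)) \<partial>Q x) \<partial>\<mu>)"
proof -
  have s: "sets \<mu> = sets borel" and p: "prob_space \<mu>" using \<mu> by (auto simp: borel_prob_def)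
  have sQ: "sets (Q x) = sets borel" for x using Q by (auto simp: stoch_kernel_def borel_prob_def)
  have "(\<lambda>x. distr (Q x) N (\<lambda>y. h (x, y))) \<in> measurable borel (subprob_algebra N)"
    using h stoch_kernel_measurable[OF Q] by (intro measurable_distr2) simp_all
  then have K: "(\<lambda>x. distr (Q x) N (\<lambda>y. h (x, y))) \<in> measurable \<mu> (subprob_algebra N)"
    by (subst measurable_cong_sets[OF s refl])
  show "sets J = sets N"
    unfolding J_def by (intro sets_bind[OF sets_kernel[OF K]]) (auto simp: prob_space.not_empty[OF p])
  assume f[measurable]: "f \<in> borel_measurable N"
  have "(\<integral>\<^sup>+p. f p \<partial>J) = (\<integral>\<^sup>+x. (\<integral>\<^sup>+p. f p \<partial>distr (Q x) N (\<lambda>y. h (x, y))) \<partial>\<mu>)"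
    unfolding J_def by (intro nn_integral_bind[OF f K])
  also have "\<dots> = (\<integral>\<^sup>+x. (\<integral>\<^sup>+y. f (h (x, y)) \<partial>Q x) \<partial>\<mu>)"
  proof (intro nn_integral_cong)
    fix x
    have "(\<lambda>y. h (x, y)) \<in> measurable borel N" by measurable
    then have "(\<lambda>y. h (x, y)) \<in> measurable (Q x) N" by (subst measurable_cong_sets[OF sQ refl])
    then show "(\<integral>\<^sup>+p. f p \<partial>distr (Q x) N (\<lambda>y. h (x, y))) = (\<integral>\<^sup>+y. f (h (x, y)) \<partial>Q x)"
      by (rule nn_integral_distr) simp
  qed
  finally show "(\<integral>\<^sup>+p. f p \<partial>J) = (\<integral>\<^sup>+x. (\<integral>\<^sup>+y. f (h (x, y)) \<partial>Q x) \<partial>\<mu>)" .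
qed

lemma
  assumes "borel_prob \<mu>" "stoch_kernel Q"
  shows sets_joint_law: "sets (joint_law \<mu> Q) = sets (borel \<Otimes>\<^sub>M borel)"
    and nn_integral_joint_law: "f \<in> borel_measurable (borel \<Otimes>\<^sub>M borel) \<Longrightarrow>
      (\<integral>\<^sup>+p. f p \<partial>joint_law \<mu> Q) = (\<integral>\<^sup>+x. (\<integral>\<^sup>+y. f (x, y) \<partial>Q x) \<partial>\<mu>)"
  unfolding joint_law_def
  using sets_bind_distr[OF assms, of "\<lambda>p. p" "borel \<Otimes>\<^sub>M borel"]
    nn_integral_bind_distr[OF assms, of "\<lambda>p. p" "borel \<Otimes>\<^sub>M borel" f]
  by simp_all

lemma measurable_emeasure_kernel_section:
  assumes Q: "stoch_kernel Q" and A: "A \<in> sets (borel \<Otimes>\<^sub>M borel)"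
  shows "(\<lambda>x. emeasure (Q x) (Pair x -` A)) \<in> borel_measurable borel"
proof -
  have "(\<lambda>x. emeasure (Q x) ((\<lambda>x. Pair x -` A) x)) \<in> borel_measurable borel"
  proof (rule emeasure_measurable_subprob_algebra2[OF _ stoch_kernel_measurable[OF Q]])
    have "(SIGMA x:space borel. Pair x -` A) = A" by auto
    then show "(SIGMA x:space borel. Pair x -` A) \<in> sets (borel \<Otimes>\<^sub>M borel)" using A by simp
  qed
  then show ?thesis .
qed

lemma space_borel_prob: "borel_prob \<mu> \<Longrightarrow> space \<mu> = UNIV"
  unfolding borel_prob_def using sets_eq_imp_space_eq[of \<mu> borel] by simp

lemma borel_prob_emeasure_UNIV: "borel_prob \<mu> \<Longrightarrow> emeasure \<mu> UNIV = 1"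
  using space_borel_prob[of \<mu>] prob_space.emeasure_space_1[of \<mu>] by (simp add: borel_prob_def)

lemma
  assumes \<mu>: "borel_prob \<mu>" and Q: "stoch_kernel Q"
  shows prob_space_joint_law: "prob_space (joint_law \<mu> Q)"
    and distr_fst_joint_law: "distr (joint_law \<mu> Q) borel fst = \<mu>"
    and borel_prob_snd_joint_law: "borel_prob (distr (joint_law \<mu> Q) borel snd)"
proof -
  have s[measurable_cong]: "sets \<mu> = sets borel" and p: "prob_space \<mu>" using \<mu> by (auto simp: borel_prob_def)
  have Q1: "emeasure (Q x) (space (Q x)) = 1" for x
    using Q unfolding stoch_kernel_def borel_prob_def by (auto intro: prob_space.emeasure_space_1)
  have sJ[measurable_cong]: "sets (joint_law \<mu> Q) = sets (borel \<Otimes>\<^sub>M borel)"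
    by (rule sets_joint_law[OF assms])
  have "emeasure (joint_law \<mu> Q) (space (joint_law \<mu> Q)) = (\<integral>\<^sup>+p. 1 \<partial>joint_law \<mu> Q)" by simp
  also have "\<dots> = (\<integral>\<^sup>+x. (\<integral>\<^sup>+y. 1 \<partial>Q x) \<partial>\<mu>)" by (rule nn_integral_joint_law[OF assms]) simp
  also have "\<dots> = 1" using prob_space.emeasure_space_1[OF p] by (simp add: Q1)
  finally show P: "prob_space (joint_law \<mu> Q)" by (rule prob_spaceI)
  show "borel_prob (distr (joint_law \<mu> Q) borel snd)"
    unfolding borel_prob_def by (auto intro!: prob_space.prob_space_distr[OF P])
  show "distr (joint_law \<mu> Q) borel fst = \<mu>"
  proof (rule measure_eqI)
    fix A assume "A \<in> sets (distr (joint_law \<mu> Q) borel fst)"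
    then have [measurable]: "A \<in> sets borel" by simp
    have "emeasure (distr (joint_law \<mu> Q) borel fst) A = (\<integral>\<^sup>+p. indicator A (fst p) \<partial>joint_law \<mu> Q)"
      by (subst nn_integral_indicator[symmetric], simp, subst nn_integral_distr) measurable
    also have "\<dots> = (\<integral>\<^sup>+x. (\<integral>\<^sup>+y. indicator A x \<partial>Q x) \<partial>\<mu>)"
      by (subst nn_integral_joint_law[OF assms]) simp_all
    also have "\<dots> = emeasure \<mu> A" by (simp add: Q1 s)
    finally show "emeasure (distr (joint_law \<mu> Q) borel fst) A = emeasure \<mu> A" .
  qed (simp add: s)
qed

text \<open>The uniform mixture of \<open>S\<close> has exactly the common null sets. It is formed
  once for the input laws and once for the output laws.\<close>

lemma finite_borel_probs_dominated:
  assumes S: "finite S" "S \<noteq> {}" and prob: "\<And>\<mu>. \<mu> \<in> S \<Longrightarrow> borel_prob \<mu>"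
  obtains \<rho> where "borel_prob \<rho>"
    "\<And>A. A \<in> sets borel \<Longrightarrow> emeasure \<rho> A = 0 \<longleftrightarrow> (\<forall>\<mu>\<in>S. emeasure \<mu> A = 0)"
proof -
  obtain \<mu>0 where "\<mu>0 \<in> S" using S by blast
  let ?p = "measure_pmf (pmf_of_set S)"
  \<comment> \<open>A kernel has to give a measure on \<open>borel\<close> at every argument, so
    outside \<open>S\<close> the identity is replaced by a fixed member of \<open>S\<close>.\<close>
  let ?K = "\<lambda>\<mu>. if \<mu> \<in> S then \<mu> else \<mu>0"
  have KS: "?K \<mu> \<in> S" for \<mu> using \<open>\<mu>0 \<in> S\<close> by simp
  have K: "?K \<in> measurable ?p (subprob_algebra borel)"
    using prob[OF KS] unfolding measurable_pmf_measure1 space_subprob_algebra borel_prob_def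
    by (auto intro: prob_space_imp_subprob_space)
  let ?\<rho> = "?p \<bind> ?K"
  have sets: "sets ?\<rho> = sets borel"
    by (intro sets_bind[OF sets_kernel[OF K]]) auto
  have em: "emeasure ?\<rho> A = (\<integral>\<^sup>+\<mu>. emeasure (?K \<mu>) A \<partial>?p)" if "A \<in> sets borel" for A
    using that by (intro emeasure_bind[OF _ K]) auto
  have "emeasure ?\<rho> UNIV = (\<integral>\<^sup>+\<mu>. emeasure (?K \<mu>) UNIV \<partial>?p)" by (rule em) simp
  also have "\<dots> = (\<integral>\<^sup>+\<mu>. 1 \<partial>?p)"
    using borel_prob_emeasure_UNIV[OF prob[OF KS]] by (intro nn_integral_cong) blast
  also have "\<dots> = 1" by simp
  finally have "borel_prob ?\<rho>"
    unfolding borel_prob_def using sets sets_eq_imp_space_eq[OF sets] by (auto intro!: prob_spaceI)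
  moreover have "emeasure ?\<rho> A = 0 \<longleftrightarrow> (\<forall>\<mu>\<in>S. emeasure \<mu> A = 0)" if "A \<in> sets borel" for A
    unfolding em[OF that]
    by (subst nn_integral_0_iff_AE) (auto simp: AE_measure_pmf_iff set_pmf_of_set[OF S(2,1)])
  ultimately show thesis by (rule that)
qed

text \<open>Densities taken separately for each input law would agree only almost everywhere, while
  the sampler needs one \<open>W\<close>. A single derivative is therefore taken for the mixture
  \<open>\<rho>\<close> of the input laws, relative to \<open>\<rho> \<Otimes>\<^sub>M R\<close>
  with \<open>R\<close> the mixture of the output laws, and restricted to each \<open>\<mu>\<close>
  afterwards.\<close>

lemma coupling_exists:
  fixes S :: "'a::polish_space measure set" and Q :: "'a \<Rightarrow> 'b::polish_space measure"
  assumes S: "finite S" "S \<noteq> {}" and prob: "\<And>\<mu>. \<mu> \<in> S \<Longrightarrow> borel_prob \<mu>" and Q: "stoch_kernel Q"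
    and ac: "\<And>\<mu>. \<mu> \<in> S \<Longrightarrow>
      absolutely_continuous (\<mu> \<Otimes>\<^sub>M distr (joint_law \<mu> Q) borel snd) (joint_law \<mu> Q)"
  obtains R W where "coupling R W"
    "\<And>\<mu>. \<mu> \<in> S \<Longrightarrow> joint_law \<mu> Q = density (\<mu> \<Otimes>\<^sub>M R) (\<lambda>(x, y). ennreal (W x y))"
proof -
  let ?PY = "\<lambda>\<mu>. distr (joint_law \<mu> Q) borel snd"
  obtain \<rho> where \<rho>: "borel_prob \<rho>"
    and \<rho>0: "\<And>A. A \<in> sets borel \<Longrightarrow> emeasure \<rho> A = 0 \<longleftrightarrow> (\<forall>\<mu>\<in>S. emeasure \<mu> A = 0)"
    using finite_borel_probs_dominated[OF S prob] by blast
  have PY: "\<And>\<nu>. \<nu> \<in> ?PY ` S \<Longrightarrow> borel_prob \<nu>"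
    using borel_prob_snd_joint_law[OF prob Q] by blast
  have S': "finite (?PY ` S)" "?PY ` S \<noteq> {}" using S by auto
  obtain R where R: "borel_prob R"
    and R0: "\<And>A. A \<in> sets borel \<Longrightarrow> emeasure R A = 0 \<longleftrightarrow> (\<forall>\<nu>\<in>?PY ` S. emeasure \<nu> A = 0)"
    using finite_borel_probs_dominated[OF S' PY] by blast
  have s\<rho>[measurable_cong]: "sets \<rho> = sets borel" and sR[measurable_cong]: "sets R = sets borel"
    using \<rho> R by (auto simp: borel_prob_def)
  interpret \<rho>: prob_space \<rho> using \<rho> by (simp add: borel_prob_def)
  interpret R: borel_prob_space R using R by (auto simp: borel_prob_def borel_prob_space_def borel_prob_space_axioms_def)
  interpret \<rho>R: pair_prob_space \<rho> R ..
  have dom: "absolutely_continuous \<rho> \<mu>" if "\<mu> \<in> S" for \<mu>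
    using \<rho>0 prob[OF that] that by (auto simp: absolutely_continuous_def null_sets_def borel_prob_def s\<rho>)
  have domR: "absolutely_continuous R (?PY \<mu>)" if "\<mu> \<in> S" for \<mu>
    using R0 that by (auto simp: absolutely_continuous_def null_sets_def sR)
  let ?J = "joint_law \<rho> Q"
  let ?B = "\<rho> \<Otimes>\<^sub>M R"
  interpret J: prob_space ?J by (rule prob_space_joint_law[OF \<rho> Q])
  have sB[measurable_cong]: "sets ?B = sets (borel \<Otimes>\<^sub>M borel)" by (intro sets_pair_measure_cong s\<rho> sR)
  have sJ[measurable_cong]: "sets ?J = sets (borel \<Otimes>\<^sub>M borel)" by (rule sets_joint_law[OF \<rho> Q])
  have em_joint: "emeasure (joint_law \<mu> Q) A = (\<integral>\<^sup>+x. emeasure (Q x) (Pair x -` A) \<partial>\<mu>)"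
    if "borel_prob \<mu>" and A[measurable]: "A \<in> sets (borel \<Otimes>\<^sub>M borel)" for \<mu> A
  proof -
    have sQ: "sets (Q x) = sets borel" for x using Q by (auto simp: stoch_kernel_def borel_prob_def)
    have "emeasure (joint_law \<mu> Q) A = (\<integral>\<^sup>+p. indicator A p \<partial>joint_law \<mu> Q)"
      using A sets_joint_law[OF that(1) Q] by (intro nn_integral_indicator[symmetric]) blast
    also have "\<dots> = (\<integral>\<^sup>+x. (\<integral>\<^sup>+y. indicator A (x, y) \<partial>Q x) \<partial>\<mu>)"
      by (rule nn_integral_joint_law[OF that(1) Q]) measurable
    also have "\<dots> = (\<integral>\<^sup>+x. emeasure (Q x) (Pair x -` A) \<partial>\<mu>)"
    proof (intro nn_integral_cong)
      fix x
      have "Pair x -` A \<in> sets (Q x)" unfolding sQ by (rule sets_Pair1[OF A])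
      then have "emeasure (Q x) (Pair x -` A) = (\<integral>\<^sup>+y. indicator (Pair x -` A) y \<partial>Q x)" by simp
      then show "(\<integral>\<^sup>+y. indicator A (x, y) \<partial>Q x) = emeasure (Q x) (Pair x -` A)"
        by (simp add: indicator_def)
    qed
    finally show ?thesis .
  qed
  have sec: "(\<lambda>x. emeasure (Q x) (Pair x -` A)) \<in> borel_measurable borel"
    if A: "A \<in> sets (borel \<Otimes>\<^sub>M borel)" for A
    by (rule measurable_emeasure_kernel_section[OF Q A])
  \<comment> \<open>A null set of \<open>\<rho> \<Otimes>\<^sub>M R\<close> is null for each product
    of an input law with its own output law, hence for each joint law by \<open>ac\<close>. Its
    sections are then null under \<open>Q x\<close> for almost every \<open>x\<close> under every
    \<open>\<mu>\<close>, and so for \<open>\<rho>\<close>-almost every \<open>x\<close>.\<close>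
  have ac_J: "absolutely_continuous ?B ?J"
    unfolding absolutely_continuous_def
  proof (rule subsetI)
    fix A assume nullA: "A \<in> null_sets ?B"
    have A: "A \<in> sets (borel \<Otimes>\<^sub>M borel)"
      using null_setsD2[OF nullA] unfolding sB .
    have "AE p in ?B. p \<notin> A" using nullA by (rule AE_not_in)
    then have aeB: "AE x in \<rho>. AE y in R. (x, y) \<notin> A" by (rule \<rho>R.AE_pair)
    have "emeasure (joint_law \<mu> Q) A = 0" if "\<mu> \<in> S" for \<mu>
    proof -
      have s\<mu>: "sets \<mu> = sets borel" using prob[OF that] by (simp add: borel_prob_def)
      interpret PY: prob_space "?PY \<mu>" using borel_prob_snd_joint_law[OF prob[OF that] Q] by (simp add: borel_prob_def)
      have "AE x in \<mu>. AE y in R. (x, y) \<notin> A"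
        by (rule absolutely_continuous_AE[OF _ dom[OF that] aeB]) (simp add: s\<mu> s\<rho>)
      then have "AE x in \<mu>. AE y in ?PY \<mu>. (x, y) \<notin> A"
        by eventually_elim (rule absolutely_continuous_AE[OF _ domR[OF that]], simp_all add: sR)
      then have "AE x in \<mu>. emeasure (?PY \<mu>) (Pair x -` A) = 0"
      proof eventually_elim
        case (elim x)
        have "Pair x -` A \<in> sets (?PY \<mu>)" using sets_Pair1[OF A] by simp
        with elim show ?case by (subst (asm) AE_iff_measurable[OF _ refl]) (auto simp: vimage_def)
      qed
      then have "(\<integral>\<^sup>+x. emeasure (?PY \<mu>) (Pair x -` A) \<partial>\<mu>) = 0"
        by (subst nn_integral_cong_AE[where v="\<lambda>_. 0"]) auto
      moreover have "A \<in> sets (\<mu> \<Otimes>\<^sub>M ?PY \<mu>)"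
        using A s\<mu> by (simp cong: sets_pair_measure_cong)
      ultimately have "A \<in> null_sets (\<mu> \<Otimes>\<^sub>M ?PY \<mu>)"
        by (intro null_setsI) (simp_all add: PY.emeasure_pair_measure_alt)
      then show ?thesis using ac[OF that] unfolding absolutely_continuous_def by blast
    qed
    then have *: "AE x in \<mu>. emeasure (Q x) (Pair x -` A) = 0" if "\<mu> \<in> S" for \<mu>
      using em_joint[OF prob A] that sec[OF A] prob[OF that]
      by (subst nn_integral_0_iff_AE[symmetric]) (auto simp: borel_prob_def cong: measurable_cong_sets)
    let ?N = "{x. emeasure (Q x) (Pair x -` A) \<noteq> 0}"
    have N: "?N \<in> sets borel" using sec[OF A] by measurable
    have "emeasure \<mu> ?N = 0" if "\<mu> \<in> S" for \<mu>
      using *[OF that] AE_iff_measurable[of ?N \<mu>] N prob[OF that] space_borel_prob[OF prob[OF that]]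
      by (auto simp: borel_prob_def)
    then have "emeasure \<rho> ?N = 0" using \<rho>0[OF N] by blast
    then have "AE x in \<rho>. emeasure (Q x) (Pair x -` A) = 0"
      using AE_iff_measurable[of ?N \<rho>] N space_borel_prob[OF \<rho>] by (auto simp: s\<rho>)
    then have "emeasure ?J A = 0"
      unfolding em_joint[OF \<rho> A] by (subst nn_integral_cong_AE[where v="\<lambda>_. 0"]) auto
    then show "A \<in> null_sets ?J" by (rule null_setsI) (simp add: sJ A)
  qed
  define V where "V p = enn2real (RN_deriv ?B ?J p)" for p
  have V[measurable]: "V \<in> borel_measurable (borel \<Otimes>\<^sub>M borel)"
    using borel_measurable_RN_deriv[of ?B ?J] unfolding V_def[abs_def]
    by (subst (asm) measurable_cong_sets[OF sB refl]) measurable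
  have V0: "0 \<le> V p" for p by (simp add: V_def)
  have J_eq: "density ?B V = ?J"
  proof -
    have fin: "AE p in ?B. RN_deriv ?B ?J p \<noteq> \<infinity>"
      by (intro \<rho>R.RN_deriv_finite J.sigma_finite_measure_axioms ac_J) (simp only: sB sJ)
    have "density ?B V = density ?B (RN_deriv ?B ?J)"
      using fin by (intro density_cong) (measurable, auto simp: V_def less_top)
    also have "\<dots> = ?J"
      by (intro \<rho>R.density_RN_deriv ac_J) (simp only: sB sJ)
    finally show ?thesis .
  qed
  have int_J: "(\<integral>\<^sup>+x. (\<integral>\<^sup>+y. f (x, y) \<partial>Q x) \<partial>\<rho>) = (\<integral>\<^sup>+x. (\<integral>\<^sup>+y. ennreal (V (x, y)) * f (x, y) \<partial>R) \<partial>\<rho>)"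
    if f[measurable]: "f \<in> borel_measurable (borel \<Otimes>\<^sub>M borel)" for f :: "'a \<times> 'b \<Rightarrow> ennreal"
  proof -
    have "(\<integral>\<^sup>+x. (\<integral>\<^sup>+y. f (x, y) \<partial>Q x) \<partial>\<rho>) = (\<integral>\<^sup>+p. f p \<partial>density ?B V)"
      unfolding J_eq by (rule nn_integral_joint_law[OF \<rho> Q, symmetric]) measurable
    also have "\<dots> = (\<integral>\<^sup>+p. ennreal (V p) * f p \<partial>?B)"
      by (rule nn_integral_density) measurable
    also have "\<dots> = (\<integral>\<^sup>+x. (\<integral>\<^sup>+y. ennreal (V (x, y)) * f (x, y) \<partial>R) \<partial>\<rho>)"
      by (rule R.nn_integral_fst[symmetric]) measurable
    finally show ?thesis .
  qed
  have [measurable]: "(\<lambda>x. \<integral>\<^sup>+y. V (x, y) \<partial>R) \<in> borel_measurable borel"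
    by (rule R.borel_measurable_nn_integral) measurable
  have Qp: "borel_prob (Q x)" for x using Q by (simp add: stoch_kernel_def)
  have Q1: "emeasure (Q x) UNIV = 1" for x by (rule borel_prob_emeasure_UNIV[OF Qp])
  have spQ: "space (Q x) = UNIV" for x by (rule space_borel_prob[OF Qp])
  \<comment> \<open>Testing the density on sets that restrict only the input recovers the first
    marginal \<open>\<rho>\<close>, which forces the sections of \<open>V\<close> to integrate to 1
    almost everywhere.\<close>
  have good: "AE x in \<rho>. (\<integral>\<^sup>+y. V (x, y) \<partial>R) = 1"
  proof -
    have "density \<rho> (\<lambda>x. \<integral>\<^sup>+y. V (x, y) \<partial>R) = density \<rho> (\<lambda>_. 1)"
    proof (rule measure_eqI)
      fix A assume "A \<in> sets (density \<rho> (\<lambda>x. \<integral>\<^sup>+y. V (x, y) \<partial>R))"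
      then have A[measurable]: "A \<in> sets borel" by (simp add: s\<rho>)
      have "emeasure (density \<rho> (\<lambda>x. \<integral>\<^sup>+y. V (x, y) \<partial>R)) A = (\<integral>\<^sup>+x. (\<integral>\<^sup>+y. V (x, y) \<partial>R) * indicator A x \<partial>\<rho>)"
        by (rule emeasure_density) measurable
      also have "\<dots> = (\<integral>\<^sup>+x. (\<integral>\<^sup>+y. ennreal (V (x, y)) * indicator A x \<partial>R) \<partial>\<rho>)"
        by (intro nn_integral_cong nn_integral_multc[symmetric]) measurable
      also have "\<dots> = (\<integral>\<^sup>+x. (\<integral>\<^sup>+y. indicator A x \<partial>Q x) \<partial>\<rho>)"
        using int_J[of "\<lambda>p. indicator A (fst p)"] by simp
      also have "\<dots> = emeasure (density \<rho> (\<lambda>_. 1)) A"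
        by (simp add: Q1 spQ density_1 s\<rho>)
      finally show "emeasure (density \<rho> (\<lambda>x. \<integral>\<^sup>+y. V (x, y) \<partial>R)) A = emeasure (density \<rho> (\<lambda>_. 1)) A" .
    qed simp
    then show ?thesis by (intro \<rho>.density_unique) measurable
  qed
  \<comment> \<open>For the inputs whose section of \<open>V\<close> is not normalised, the constant
    1 is used, that is, the output law \<open>R\<close> itself; these inputs are null for every
    \<open>\<mu>\<close> in \<open>S\<close>.\<close>
  define W where "W x y = (if (\<integral>\<^sup>+y. V (x, y) \<partial>R) = 1 then V (x, y) else 1)" for x y
  have W[measurable]: "(\<lambda>(x, y). W x y) \<in> borel_measurable (borel \<Otimes>\<^sub>M borel)"
    unfolding W_def by measurable
  have "coupling R W"
  proof
    show "0 \<le> W x y" for x y by (simp add: W_def V0)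
    show "(\<integral>\<^sup>+y. W x y \<partial>R) = 1" for x
      using R.emeasure_space_1 by (cases "(\<integral>\<^sup>+y. V (x, y) \<partial>R) = 1") (simp_all add: W_def)
  qed (rule W)
  moreover have "joint_law \<mu> Q = density (\<mu> \<Otimes>\<^sub>M R) (\<lambda>(x, y). ennreal (W x y))" if "\<mu> \<in> S" for \<mu>
  proof (rule measure_eqI)
    have s\<mu>[measurable_cong]: "sets \<mu> = sets borel" and p\<mu>: "prob_space \<mu>"
      using prob[OF that] by (auto simp: borel_prob_def)
    interpret \<mu>: prob_space \<mu> by fact
    have sMR: "sets (\<mu> \<Otimes>\<^sub>M R) = sets (borel \<Otimes>\<^sub>M borel)" by (intro sets_pair_measure_cong s\<mu> sR)
    show "sets (joint_law \<mu> Q) = sets (density (\<mu> \<Otimes>\<^sub>M R) (\<lambda>(x, y). ennreal (W x y)))"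
      by (simp only: sets_joint_law[OF prob[OF that] Q] sMR sets_density)
    fix A assume "A \<in> sets (joint_law \<mu> Q)"
    then have A[measurable]: "A \<in> sets (borel \<Otimes>\<^sub>M borel)"
      by (simp add: sets_joint_law[OF prob[OF that] Q])
    \<comment> \<open>The identity \<open>int_J\<close> speaks of \<open>\<rho>\<close> only;
      putting the density of \<open>\<mu>\<close> with respect to \<open>\<rho>\<close> into the
      test function carries it over to \<open>\<mu>\<close>.\<close>
    define m where "m = RN_deriv \<rho> \<mu>"
    have m[measurable]: "m \<in> borel_measurable borel"
      using borel_measurable_RN_deriv[of \<rho> \<mu>] unfolding m_def by (subst (asm) measurable_cong_sets[OF s\<rho> refl])
    have \<mu>_eq: "density \<rho> m = \<mu>"
      unfolding m_def by (intro \<rho>.density_RN_deriv dom[OF that]) (simp add: s\<mu> s\<rho>)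
    have [measurable]: "(\<lambda>x. \<integral>\<^sup>+y. ennreal (V (x, y)) * indicator A (x, y) \<partial>R) \<in> borel_measurable borel"
      by (rule R.borel_measurable_nn_integral) measurable
    have "emeasure (joint_law \<mu> Q) A = (\<integral>\<^sup>+x. emeasure (Q x) (Pair x -` A) \<partial>density \<rho> m)"
      unfolding \<mu>_eq by (rule em_joint[OF prob[OF that] A])
    also have "\<dots> = (\<integral>\<^sup>+x. m x * emeasure (Q x) (Pair x -` A) \<partial>\<rho>)"
      using sec[OF A] by (intro nn_integral_density) (measurable, simp cong: measurable_cong_sets add: s\<rho>)
    also have "\<dots> = (\<integral>\<^sup>+x. (\<integral>\<^sup>+y. m x * indicator A (x, y) \<partial>Q x) \<partial>\<rho>)"
    proof (intro nn_integral_cong)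
      fix x
      have "Pair x -` A \<in> sets (Q x)"
        using sets_Pair1[OF A] Q by (auto simp: stoch_kernel_def borel_prob_def)
      then have "m x * emeasure (Q x) (Pair x -` A) = (\<integral>\<^sup>+y. m x * indicator (Pair x -` A) y \<partial>Q x)"
        by (simp add: nn_integral_cmult_indicator)
      then show "m x * emeasure (Q x) (Pair x -` A) = (\<integral>\<^sup>+y. m x * indicator A (x, y) \<partial>Q x)"
        by (simp add: indicator_def)
    qed
    also have "\<dots> = (\<integral>\<^sup>+x. (\<integral>\<^sup>+y. ennreal (V (x, y)) * (m x * indicator A (x, y)) \<partial>R) \<partial>\<rho>)"
      using int_J[of "\<lambda>p. m (fst p) * indicator A p"] by simp
    also have "\<dots> = (\<integral>\<^sup>+x. m x * (\<integral>\<^sup>+y. ennreal (V (x, y)) * indicator A (x, y) \<partial>R) \<partial>\<rho>)"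
    proof (intro nn_integral_cong)
      fix x
      have "(\<integral>\<^sup>+y. ennreal (V (x, y)) * (m x * indicator A (x, y)) \<partial>R) = (\<integral>\<^sup>+y. m x * (ennreal (V (x, y)) * indicator A (x, y)) \<partial>R)"
        by (simp only: mult.left_commute)
      also have "\<dots> = m x * (\<integral>\<^sup>+y. ennreal (V (x, y)) * indicator A (x, y) \<partial>R)"
        by (rule nn_integral_cmult) measurable
      finally show "(\<integral>\<^sup>+y. ennreal (V (x, y)) * (m x * indicator A (x, y)) \<partial>R) = m x * (\<integral>\<^sup>+y. ennreal (V (x, y)) * indicator A (x, y) \<partial>R)" .
    qed
    also have "\<dots> = (\<integral>\<^sup>+x. (\<integral>\<^sup>+y. ennreal (V (x, y)) * indicator A (x, y) \<partial>R) \<partial>density \<rho> m)"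
      by (rule nn_integral_density[symmetric]) measurable
    also have "\<dots> = (\<integral>\<^sup>+x. (\<integral>\<^sup>+y. ennreal (W x y) * indicator A (x, y) \<partial>R) \<partial>\<mu>)"
      unfolding \<mu>_eq
    proof (intro nn_integral_cong_AE)
      have "AE x in \<mu>. (\<integral>\<^sup>+y. V (x, y) \<partial>R) = 1"
        by (rule absolutely_continuous_AE[OF _ dom[OF that] good]) (simp add: s\<mu> s\<rho>)
      then show "AE x in \<mu>. (\<integral>\<^sup>+y. ennreal (V (x, y)) * indicator A (x, y) \<partial>R) = (\<integral>\<^sup>+y. ennreal (W x y) * indicator A (x, y) \<partial>R)"
        by eventually_elim (simp add: W_def)
    qed
    also have "\<dots> = (\<integral>\<^sup>+p. ennreal (case p of (x, y) \<Rightarrow> W x y) * indicator A p \<partial>(\<mu> \<Otimes>\<^sub>M R))"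
    proof -
      have "(\<lambda>p. ennreal (case p of (x, y) \<Rightarrow> W x y) * indicator A p) \<in> borel_measurable (\<mu> \<Otimes>\<^sub>M R)"
        by measurable
      from R.nn_integral_fst[OF this] show ?thesis by simp
    qed
    also have "\<dots> = emeasure (density (\<mu> \<Otimes>\<^sub>M R) (\<lambda>(x, y). ennreal (W x y))) A"
    proof -
      have "(\<lambda>(x, y). ennreal (W x y)) \<in> borel_measurable (\<mu> \<Otimes>\<^sub>M R)" by measurable
      moreover have "A \<in> sets (\<mu> \<Otimes>\<^sub>M R)" unfolding sMR by (rule A)
      ultimately show ?thesis by (subst emeasure_density) (simp_all add: case_prod_beta')
    qed
    finally show "emeasure (joint_law \<mu> Q) A = emeasure (density (\<mu> \<Otimes>\<^sub>M R) (\<lambda>(x, y). ennreal (W x y))) A" .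
  qed
  ultimately show thesis by (rule that)
qed

section \<open>Conditional entropy and the main result\<close>

text \<open>\<open>cond_entropy\<close> is an infimum over disintegrations, so exhibiting one bounds
  it from above. By independence, the law of \<open>g x z\<close> under \<open>x\<close> distributed
  as \<open>\<mu>\<close>, with \<open>z\<close> fixed, is such a disintegration.\<close>

lemma cond_entropy_distr_le:
  fixes g :: "'a::polish_space \<Rightarrow> real \<Rightarrow> 'b::polish_space"
  assumes \<mu>: "borel_prob \<mu>" and \<nu>: "borel_prob \<nu>"
    and g[measurable]: "(\<lambda>(x, z). g x z) \<in> borel_measurable (borel \<Otimes>\<^sub>M borel)"
  shows "cond_entropy (distr (\<mu> \<Otimes>\<^sub>M \<nu>) (borel \<Otimes>\<^sub>M borel) (\<lambda>(x, z). (g x z, z)))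
    \<le> (\<integral>\<^sup>+z. disc_entropy (distr \<mu> borel (\<lambda>x. g x z)) \<partial>\<nu>)"
proof -
  have s\<mu>[measurable_cong]: "sets \<mu> = sets borel" and s\<nu>[measurable_cong]: "sets \<nu> = sets borel"
    using \<mu> \<nu> by (auto simp: borel_prob_def)
  interpret M: prob_space \<mu> using \<mu> by (simp add: borel_prob_def)
  interpret N: prob_space \<nu> using \<nu> by (simp add: borel_prob_def)
  interpret MN: pair_prob_space \<mu> \<nu> ..
  interpret NM: pair_prob_space \<nu> \<mu> ..
  let ?P = "distr (\<mu> \<Otimes>\<^sub>M \<nu>) (borel \<Otimes>\<^sub>M borel) (\<lambda>(x, z). (g x z, z))"
  let ?K = "\<lambda>z. distr \<mu> borel (\<lambda>x. g x z)"
  have gz[measurable]: "(\<lambda>x. g x z) \<in> borel_measurable \<mu>" for z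
    by measurable
  have [measurable]: "(\<lambda>(x, z). (g x z, z)) \<in> measurable (\<mu> \<Otimes>\<^sub>M \<nu>) (borel \<Otimes>\<^sub>M borel)"
    by measurable
  have K: "stoch_kernel ?K"
    unfolding stoch_kernel_def borel_prob_def
  proof (intro conjI allI ballI)
    show "prob_space (?K z)" for z by (rule M.prob_space_distr) measurable
    fix A :: "'b set" assume A[measurable]: "A \<in> sets borel"
    have "(\<lambda>z. \<integral>\<^sup>+x. indicator A (g x z) \<partial>\<mu>) \<in> borel_measurable borel"
      by (rule M.borel_measurable_nn_integral) measurable
    moreover have "(\<integral>\<^sup>+x. indicator A (g x z) \<partial>\<mu>) = emeasure (?K z) A" for z
      by (subst nn_integral_indicator[symmetric], simp, subst nn_integral_distr) measurable
    ultimately show "(\<lambda>z. emeasure (?K z) A) \<in> borel_measurable borel" by simp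
  qed simp
  have snd_P: "distr ?P borel snd = \<nu>"
  proof (rule measure_eqI)
    fix A assume "A \<in> sets (distr ?P borel snd)"
    then have A[measurable]: "A \<in> sets borel" by simp
    have "emeasure (distr ?P borel snd) A = emeasure (\<mu> \<Otimes>\<^sub>M \<nu>) (space \<mu> \<times> A)"
    proof -
      have "distr ?P borel snd = distr (\<mu> \<Otimes>\<^sub>M \<nu>) borel snd"
        by (subst distr_distr) (simp_all add: o_def case_prod_beta')
      moreover have "snd -` A \<inter> space (\<mu> \<Otimes>\<^sub>M \<nu>) = space \<mu> \<times> A"
        using sets.sets_into_space[of A \<nu>] by (auto simp: space_pair_measure s\<nu>)
      moreover have "snd \<in> measurable (\<mu> \<Otimes>\<^sub>M \<nu>) borel" by measurable
      ultimately show ?thesis by (simp only: emeasure_distr A)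
    qed
    also have "\<dots> = emeasure \<nu> A"
      by (subst N.emeasure_pair_measure_Times) (auto simp: s\<nu> M.emeasure_space_1)
    finally show "emeasure (distr ?P borel snd) A = emeasure \<nu> A" .
  qed (simp add: s\<nu>)
  have disint: "?P = \<nu> \<bind> (\<lambda>z. distr (?K z) (borel \<Otimes>\<^sub>M borel) (\<lambda>y. (y, z)))"
  proof (rule measure_eqI)
    have h: "(\<lambda>p. (snd p, fst p)) \<in> measurable (borel \<Otimes>\<^sub>M borel) (borel \<Otimes>\<^sub>M borel :: ('b \<times> real) measure)"
      by measurable
    note bind = sets_bind_distr[OF \<nu> K h] nn_integral_bind_distr[OF \<nu> K h]
    show sets: "sets ?P = sets (\<nu> \<bind> (\<lambda>z. distr (?K z) (borel \<Otimes>\<^sub>M borel) (\<lambda>y. (y, z))))"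
      using bind(1) by simp
    fix A assume AP: "A \<in> sets ?P"
    have A': "A \<in> sets (\<nu> \<bind> (\<lambda>z. distr (?K z) (borel \<Otimes>\<^sub>M borel) (\<lambda>y. (y, z))))"
      using AP by (simp only: sets)
    have A[measurable]: "A \<in> sets (borel \<Otimes>\<^sub>M borel)" using AP by simp
    have "emeasure ?P A = (\<integral>\<^sup>+p. indicator A p \<partial>?P)" by simp
    also have "\<dots> = (\<integral>\<^sup>+p. indicator A (case p of (x, z) \<Rightarrow> (g x z, z)) \<partial>(\<mu> \<Otimes>\<^sub>M \<nu>))"
      by (rule nn_integral_distr) measurable
    also have "\<dots> = (\<integral>\<^sup>+z. (\<integral>\<^sup>+x. indicator A (g x z, z) \<partial>\<mu>) \<partial>\<nu>)"
      by (subst MN.nn_integral_snd[symmetric]) simp_all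
    also have "\<dots> = (\<integral>\<^sup>+z. (\<integral>\<^sup>+y. indicator A (y, z) \<partial>?K z) \<partial>\<nu>)"
      by (intro nn_integral_cong nn_integral_distr[symmetric]) measurable
    also have "\<dots> = (\<integral>\<^sup>+p. indicator A p \<partial>(\<nu> \<bind> (\<lambda>z. distr (?K z) (borel \<Otimes>\<^sub>M borel) (\<lambda>y. (y, z)))))"
      using bind(2)[of "indicator A"] by simp
    also have "\<dots> = emeasure (\<nu> \<bind> (\<lambda>z. distr (?K z) (borel \<Otimes>\<^sub>M borel) (\<lambda>y. (y, z)))) A"
      using A' by (rule nn_integral_indicator)
    finally show "emeasure ?P A = emeasure (\<nu> \<bind> (\<lambda>z. distr (?K z) (borel \<Otimes>\<^sub>M borel) (\<lambda>y. (y, z)))) A" .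
  qed
  have "cond_entropy ?P \<le> (\<integral>\<^sup>+z. disc_entropy (?K z) \<partial>distr ?P borel snd)"
    unfolding cond_entropy_def
    by (rule INF_lower) (use K disint snd_P in simp)
  then show ?thesis by (simp only: snd_P)
qed

lemma mutual_info_finite_imp_absolutely_continuous:
  "mutual_info P < \<infinity> \<Longrightarrow> absolutely_continuous (distr P borel fst \<Otimes>\<^sub>M distr P borel snd) P"
  by (auto simp: mutual_info_def Let_def split: if_splits)

section \<open>The sampler under one input law\<close>

context coupling
begin

text \<open>The density is the \<open>\<mu>\<close>-average of \<open>W x y\<close>. It can be
  infinite on an \<open>R\<close>-null set of \<open>y\<close>, where the conversion to a real
  number puts 0.\<close>

lemma marginal_density:
  assumes \<mu>: "borel_prob \<mu>" and P: "prob_space P" "P = density (\<mu> \<Otimes>\<^sub>M R) (\<lambda>(x, y). ennreal (W x y))"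
  obtains r where "r \<in> borel_measurable borel" "\<And>y. 0 \<le> r y" "(\<integral>\<^sup>+y. ennreal (r y) \<partial>R) = 1"
    "distr P borel snd = density R (\<lambda>y. ennreal (r y))"
proof -
  have s\<mu>[measurable_cong]: "sets \<mu> = sets borel" using \<mu> by (auto simp: borel_prob_def)
  interpret M: prob_space \<mu> using \<mu> by (simp add: borel_prob_def)
  interpret P: prob_space P by fact
  interpret MR: pair_prob_space \<mu> R ..
  note W_measurable[measurable]
  define r0 where "r0 y = (\<integral>\<^sup>+x. ennreal (W x y) \<partial>\<mu>)" for y
  have r0[measurable]: "r0 \<in> borel_measurable borel"
    unfolding r0_def[abs_def] by (rule M.borel_measurable_nn_integral) measurable
  have sP: "sets P = sets (borel \<Otimes>\<^sub>M borel)"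
    unfolding P(2) sets_density by (intro sets_pair_measure_cong s\<mu> sets_R)
  have int: "(\<integral>\<^sup>+p. f (snd p) \<partial>P) = (\<integral>\<^sup>+y. r0 y * f y \<partial>R)"
    if f[measurable]: "f \<in> borel_measurable borel" for f :: "'b \<Rightarrow> ennreal"
  proof -
    have "(\<integral>\<^sup>+p. f (snd p) \<partial>P) = (\<integral>\<^sup>+p. ennreal (W (fst p) (snd p)) * f (snd p) \<partial>(\<mu> \<Otimes>\<^sub>M R))"
      unfolding P(2) by (subst nn_integral_density) (simp_all add: case_prod_beta')
    also have "\<dots> = (\<integral>\<^sup>+y. (\<integral>\<^sup>+x. ennreal (W x y) * f y \<partial>\<mu>) \<partial>R)"
      by (subst MR.nn_integral_snd[symmetric]) (simp_all add: case_prod_beta')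
    also have "\<dots> = (\<integral>\<^sup>+y. r0 y * f y \<partial>R)"
      unfolding r0_def by (intro nn_integral_cong nn_integral_multc) measurable
    finally show ?thesis .
  qed
  have r0_1: "(\<integral>\<^sup>+y. r0 y \<partial>R) = 1"
    using int[of "\<lambda>_. 1"] by (simp add: P.emeasure_space_1)
  have fin: "AE y in R. r0 y \<noteq> \<infinity>"
    using r0_1 by (intro nn_integral_PInf_AE) auto
  define r where "r y = enn2real (r0 y)" for y
  have r[measurable]: "r \<in> borel_measurable borel" unfolding r_def[abs_def] by measurable
  have r_r0: "AE y in R. ennreal (r y) = r0 y"
    using fin by eventually_elim (simp add: r_def less_top)
  have "(\<integral>\<^sup>+y. ennreal (r y) \<partial>R) = 1"
    using nn_integral_cong_AE[OF r_r0] r0_1 by simp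
  moreover have "distr P borel snd = density R (\<lambda>y. ennreal (r y))"
  proof (rule measure_eqI)
    fix A assume "A \<in> sets (distr P borel snd)"
    then have A[measurable]: "A \<in> sets borel" by simp
    have sndP: "snd \<in> measurable P borel"
      by (subst measurable_cong_sets[OF sP refl]) measurable
    have "emeasure (distr P borel snd) A = (\<integral>\<^sup>+p. indicator A (snd p) \<partial>P)"
      by (subst nn_integral_indicator[symmetric], simp, rule nn_integral_distr[OF sndP]) measurable
    also have "\<dots> = (\<integral>\<^sup>+y. r0 y * indicator A y \<partial>R)" by (rule int) measurable
    also have "\<dots> = (\<integral>\<^sup>+y. ennreal (r y) * indicator A y \<partial>R)"
    proof (rule nn_integral_cong_AE)
      show "AE y in R. r0 y * indicator A y = ennreal (r y) * indicator A y"
        using r_r0 by eventually_elim simp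
    qed
    also have "\<dots> = emeasure (density R (\<lambda>y. ennreal (r y))) A"
      using r A by (subst emeasure_density) (simp_all cong: measurable_cong_sets)
    finally show "emeasure (distr P borel snd) A = emeasure (density R (\<lambda>y. ennreal (r y))) A" .
  qed simp
  ultimately show thesis using that[of r] by (simp add: r_def)
qed

text \<open>Under the law of \<open>e\<close> the decoded value \<open>d z\<close> is again the
  array, so for each fixed input the inner integral is the one computed by
  \<open>S.distr_pick\<close>.\<close>

lemma distr_pick_joint:
  assumes \<mu>: "borel_prob \<mu>" and P: "P = density (\<mu> \<Otimes>\<^sub>M R) (\<lambda>(x, y). ennreal (W x y))"
    and e[measurable]: "e \<in> borel_measurable borel" and d[measurable]: "d \<in> borel_measurable borel"
    and de: "\<And>\<omega>. d (e \<omega>) = \<omega>"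
  shows "distr (\<mu> \<Otimes>\<^sub>M distr (array R) borel e) (borel \<Otimes>\<^sub>M borel) (\<lambda>(x, z). (x, pick R (W x) (d z))) = P"
proof (rule measure_eqI)
  let ?\<nu> = "distr (array R) borel e"
  have s\<mu>[measurable_cong]: "sets \<mu> = sets borel" using \<mu> by (auto simp: borel_prob_def)
  interpret M: prob_space \<mu> using \<mu> by (simp add: borel_prob_def)
  interpret A: prob_space "array R" by (rule prob_space_array)
  have em: "e \<in> measurable (array R) borel" by (subst measurable_cong_sets[OF sets_array refl]) (rule e)
  interpret N: prob_space ?\<nu> by (rule A.prob_space_distr[OF em])
  note W_measurable[measurable]
  have g[measurable]: "(\<lambda>p. pick R (W (fst p)) (d (snd p))) \<in> borel_measurable (borel \<Otimes>\<^sub>M borel)"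
  proof -
    have "(\<lambda>p. (fst p, d (snd p))) \<in> measurable (borel \<Otimes>\<^sub>M borel) (borel \<Otimes>\<^sub>M borel)" by measurable
    from measurable_compose[OF this pick_measurable[OF W_measurable]] show ?thesis by simp
  qed
  have sMR: "sets (\<mu> \<Otimes>\<^sub>M R) = sets (borel \<Otimes>\<^sub>M borel)" by (intro sets_pair_measure_cong s\<mu> sets_R)
  let ?D = "distr (\<mu> \<Otimes>\<^sub>M ?\<nu>) (borel \<Otimes>\<^sub>M borel) (\<lambda>(x, z). (x, pick R (W x) (d z)))"
  show "sets ?D = sets P" by (simp only: P sets_density sets_distr sMR)
  fix A assume "A \<in> sets ?D"
  then have A[measurable]: "A \<in> sets (borel \<Otimes>\<^sub>M borel)" by simp
  have m: "(\<lambda>(x, z). (x, pick R (W x) (d z))) \<in> measurable (\<mu> \<Otimes>\<^sub>M ?\<nu>) (borel \<Otimes>\<^sub>M borel)"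
    unfolding case_prod_beta' by measurable
  have mA: "(\<lambda>p. indicator A (fst p, pick R (W (fst p)) (d (snd p))) :: ennreal) \<in> borel_measurable (\<mu> \<Otimes>\<^sub>M ?\<nu>)"
    by measurable
  have "emeasure ?D A = (\<integral>\<^sup>+p. indicator A p \<partial>?D)" by simp
  also have "\<dots> = (\<integral>\<^sup>+p. indicator A (fst p, pick R (W (fst p)) (d (snd p))) \<partial>(\<mu> \<Otimes>\<^sub>M ?\<nu>))"
    by (subst nn_integral_distr[OF m]) (simp_all add: case_prod_beta')
  also have "\<dots> = (\<integral>\<^sup>+x. (\<integral>\<^sup>+z. indicator A (x, pick R (W x) (d z)) \<partial>?\<nu>) \<partial>\<mu>)"
    using N.nn_integral_fst[OF mA] by simp
  also have "\<dots> = (\<integral>\<^sup>+x. (\<integral>\<^sup>+y. ennreal (W x y) * indicator A (x, y) \<partial>R) \<partial>\<mu>)"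
  proof (intro nn_integral_cong)
    fix x
    have pm: "pick R (W x) \<in> borel_measurable borel" by (rule S.pick_borel_measurable)
    have pm': "pick R (W x) \<in> measurable (array R) borel"
      by (subst measurable_cong_sets[OF sets_array refl]) (rule pm)
    have "(\<lambda>z. indicator A (x, pick R (W x) (d z)) :: ennreal) \<in> borel_measurable borel"
      using pm by measurable
    then have "(\<integral>\<^sup>+z. indicator A (x, pick R (W x) (d z)) \<partial>?\<nu>) = (\<integral>\<^sup>+\<omega>. indicator A (x, pick R (W x) (d (e \<omega>))) \<partial>array R)"
      by (intro nn_integral_distr em) simp
    also have "\<dots> = (\<integral>\<^sup>+y. indicator A (x, y) \<partial>distr (array R) borel (pick R (W x)))"
      unfolding de by (rule nn_integral_distr[OF pm', symmetric]) measurable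
    also have "\<dots> = (\<integral>\<^sup>+y. ennreal (W x y) * indicator A (x, y) \<partial>R)"
      unfolding S.distr_pick by (rule nn_integral_density) measurable
    finally show "(\<integral>\<^sup>+z. indicator A (x, pick R (W x) (d z)) \<partial>?\<nu>) = (\<integral>\<^sup>+y. ennreal (W x y) * indicator A (x, y) \<partial>R)" .
  qed
  also have "\<dots> = (\<integral>\<^sup>+p. (case p of (x, y) \<Rightarrow> ennreal (W x y)) * indicator A p \<partial>(\<mu> \<Otimes>\<^sub>M R))"
  proof -
    have "(\<lambda>p. (case p of (x, y) \<Rightarrow> ennreal (W x y)) * indicator A p) \<in> borel_measurable (\<mu> \<Otimes>\<^sub>M R)"
      by measurable
    from nn_integral_fst[OF this] show ?thesis by simp
  qed
  also have "\<dots> = emeasure P A"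
  proof -
    have "(\<lambda>(x, y). ennreal (W x y)) \<in> borel_measurable (\<mu> \<Otimes>\<^sub>M R)" by measurable
    moreover have "A \<in> sets (\<mu> \<Otimes>\<^sub>M R)" unfolding sMR by (rule A)
    ultimately show ?thesis unfolding P by (rule emeasure_density[symmetric])
  qed
  finally show "emeasure ?D A = emeasure P A" .
qed

end

theorem theorem1:
  fixes S :: "'a::polish_space measure set"
    and Q :: "'a \<Rightarrow> 'b::polish_space measure"
  assumes "finite S"
    and "\<forall>\<mu>\<in>S. borel_prob \<mu>"
    and "stoch_kernel Q"
    and "\<forall>\<mu>\<in>S. I_kernel \<mu> Q < \<infinity>"
  shows "\<exists>(\<nu> :: real measure) (g :: 'a \<Rightarrow> real \<Rightarrow> 'b).
           borel_prob \<nu> \<and>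
           (\<lambda>(x, z). g x z) \<in> borel \<Otimes>\<^sub>M borel \<rightarrow>\<^sub>M borel \<and>
           (\<forall>\<mu>\<in>S.
              distr (\<mu> \<Otimes>\<^sub>M \<nu>) (borel \<Otimes>\<^sub>M borel) (\<lambda>(x, z). (x, g x z)) = joint_law \<mu> Q \<and>
              cond_entropy (distr (\<mu> \<Otimes>\<^sub>M \<nu>) (borel \<Otimes>\<^sub>M borel) (\<lambda>(x, z). (g x z, z)))
                \<le> ennreal (real_of_ereal (I_bar S Q)
                     + log 2 (real (card S) * (real_of_ereal (I_bar S Q) + 1)) + 4))"
proof (cases "S = {}")
  \<comment> \<open>Without input laws only some probability measure and some measurable function
    are asked for; the mixtures used below require a member of \<open>S\<close>.\<close>
  case True
  have "borel_prob (return borel (0::real))"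
    by (simp add: borel_prob_def prob_space_return)
  moreover have "(\<lambda>(x, z). undefined) \<in> borel_measurable (borel \<Otimes>\<^sub>M borel :: ('a \<times> real) measure)"
    by simp
  ultimately show ?thesis using True
    by (intro exI[of _ "return borel 0"] exI[of _ "\<lambda>_ _. undefined"]) simp
next
  case False
  have prob: "borel_prob \<mu>" if "\<mu> \<in> S" for \<mu> using assms(2) that by blast
  have fin: "mutual_info (joint_law \<mu> Q) < \<infinity>" if "\<mu> \<in> S" for \<mu>
    using assms(4) that by (simp add: I_kernel_def)
  have ac: "absolutely_continuous (\<mu> \<Otimes>\<^sub>M distr (joint_law \<mu> Q) borel snd) (joint_law \<mu> Q)"
    if "\<mu> \<in> S" for \<mu>
    using mutual_info_finite_imp_absolutely_continuous[OF fin[OF that]]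
    unfolding distr_fst_joint_law[OF prob[OF that] assms(3)] .
  obtain R W where "coupling R W" and P_eq: "\<And>\<mu>. \<mu> \<in> S \<Longrightarrow>
      joint_law \<mu> Q = density (\<mu> \<Otimes>\<^sub>M R) (\<lambda>(x, y). ennreal (W x y))"
    using coupling_exists[OF assms(1) False prob assms(3) ac] by blast
  interpret coupling R W by fact
  obtain e :: "(nat \<Rightarrow> nat \<Rightarrow> 'b \<times> real) \<Rightarrow> real" and d :: "real \<Rightarrow> nat \<Rightarrow> nat \<Rightarrow> 'b \<times> real"
    where e: "e \<in> borel_measurable borel" and d: "d \<in> borel_measurable borel" and de: "\<And>\<omega>. d (e \<omega>) = \<omega>"
    using polish_retract_of_real by blast
  define \<nu> where "\<nu> = distr (array R) borel e"
  define g where "g x z = pick R (W x) (d z)" for x z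
  have em: "e \<in> measurable (array R) borel" by (subst measurable_cong_sets[OF sets_array refl]) (rule e)
  have \<nu>: "borel_prob \<nu>"
    unfolding \<nu>_def borel_prob_def by (simp add: prob_space.prob_space_distr[OF prob_space_array em])
  have g: "(\<lambda>(x, z). g x z) \<in> borel_measurable (borel \<Otimes>\<^sub>M borel)"
  proof -
    have "(\<lambda>p. (fst p, d (snd p))) \<in> measurable (borel \<Otimes>\<^sub>M borel) (borel \<Otimes>\<^sub>M borel)" using d by measurable
    from measurable_compose[OF this pick_measurable[OF W_measurable]] show ?thesis
      by (simp add: g_def case_prod_beta')
  qed
  define L where "L = real_of_ereal (I_bar S Q)"
  have info: "\<exists>I r. I_kernel \<mu> Q = ereal I \<and> 0 \<le> I \<and> r \<in> borel_measurable borel \<and> (\<forall>y. 0 \<le> r y)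
      \<and> (\<integral>\<^sup>+y. ennreal (r y) \<partial>R) = 1 \<and> (AE p in joint_law \<mu> Q. 0 < r (snd p))
      \<and> (\<integral>\<^sup>+p. log 2 (1 + W (fst p) (snd p) / r (snd p)) \<partial>joint_law \<mu> Q) \<le> ennreal (I + 1)"
    if \<mu>: "\<mu> \<in> S" for \<mu>
  proof -
    have P: "prob_space (joint_law \<mu> Q)" by (rule prob_space_joint_law[OF prob[OF \<mu>] assms(3)])
    obtain r where r: "r \<in> borel_measurable borel" "\<And>y. 0 \<le> r y" "(\<integral>\<^sup>+y. ennreal (r y) \<partial>R) = 1"
      "distr (joint_law \<mu> Q) borel snd = density R (\<lambda>y. ennreal (r y))"
      using marginal_density[OF prob[OF \<mu>] P P_eq[OF \<mu>]] by blast
    have "prob_space \<mu>" using prob[OF \<mu>] by (simp add: borel_prob_def)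
    from information_bounds[OF P prob_space_axioms sets_R this W_measurable W_nonneg r(1,2) P_eq[OF \<mu>]
        distr_fst_joint_law[OF prob[OF \<mu>] assms(3)] r(4) fin[OF \<mu>]]
    obtain I where "mutual_info (joint_law \<mu> Q) = ereal I" "0 \<le> I" "AE p in joint_law \<mu> Q. 0 < r (snd p)"
      "(\<integral>\<^sup>+p. log 2 (1 + W (fst p) (snd p) / r (snd p)) \<partial>joint_law \<mu> Q) \<le> ennreal (I + 1)"
      by blast
    then show ?thesis
      using r(1-3) unfolding I_kernel_def by (intro exI[of _ I] exI[of _ r]) simp
  qed
  \<comment> \<open>\<open>real_of_ereal\<close> sends an infinite value to 0, so the supremum has
    to be known to be finite before \<open>L\<close> can bound the individual informations.\<close>
  have bar: "\<exists>l. I_bar S Q = ereal l"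
  proof -
    define c where "c = Max ((\<lambda>\<mu>. real_of_ereal (I_kernel \<mu> Q)) ` S)"
    have "I_kernel \<mu> Q \<le> ereal c" if \<mu>: "\<mu> \<in> S" for \<mu>
    proof -
      obtain I where I: "I_kernel \<mu> Q = ereal I" using info[OF \<mu>] by blast
      have "real_of_ereal (I_kernel \<mu> Q) \<le> c"
        unfolding c_def using assms(1) \<mu> by (intro Max_ge) auto
      then show ?thesis by (simp add: I)
    qed
    then have upper: "I_bar S Q \<le> ereal c" unfolding I_bar_def by (rule SUP_least)
    obtain \<mu> where \<mu>: "\<mu> \<in> S" using False by blast
    obtain I where "I_kernel \<mu> Q = ereal I" using info[OF \<mu>] by blast
    then have "ereal I \<le> I_bar S Q" unfolding I_bar_def using \<mu> by (metis SUP_upper)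
    with upper show ?thesis by (cases "I_bar S Q") auto
  qed
  have I_le: "I \<le> L" if "\<mu> \<in> S" "I_kernel \<mu> Q = ereal I" for \<mu> I
  proof -
    have "ereal I \<le> I_bar S Q" unfolding I_bar_def using that by (metis SUP_upper)
    then show ?thesis using bar by (auto simp: L_def)
  qed
  have L0: "0 \<le> L"
  proof -
    obtain \<mu> where \<mu>: "\<mu> \<in> S" using False by blast
    then show ?thesis using info[OF \<mu>] I_le[OF \<mu>] by force
  qed
  have card: "1 \<le> real (card S)"
    using assms(1) False by (simp add: Suc_leI card_gt_0_iff)
  have "distr (\<mu> \<Otimes>\<^sub>M \<nu>) (borel \<Otimes>\<^sub>M borel) (\<lambda>(x, z). (x, g x z)) = joint_law \<mu> Q"
    if "\<mu> \<in> S" for \<mu>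
    unfolding \<nu>_def g_def by (rule distr_pick_joint[OF prob[OF that] P_eq[OF that] e d de])
  moreover have "cond_entropy (distr (\<mu> \<Otimes>\<^sub>M \<nu>) (borel \<Otimes>\<^sub>M borel) (\<lambda>(x, z). (g x z, z)))
      \<le> ennreal (L + log 2 (real (card S) * (L + 1)) + 4)" if \<mu>: "\<mu> \<in> S" for \<mu>
  proof -
    obtain I r where I: "I_kernel \<mu> Q = ereal I" "0 \<le> I"
      and r: "r \<in> borel_measurable borel" "\<And>y. 0 \<le> r y" "(\<integral>\<^sup>+y. ennreal (r y) \<partial>R) = 1"
      and r_pos: "AE p in joint_law \<mu> Q. 0 < r (snd p)"
      and le: "(\<integral>\<^sup>+p. log 2 (1 + W (fst p) (snd p) / r (snd p)) \<partial>joint_law \<mu> Q) \<le> ennreal (I + 1)"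
      using info[OF \<mu>] by blast
    have "ennreal (I + 1) \<le> ennreal (L + 1)" using I_le[OF \<mu> I(1)] by (intro ennreal_leI) simp
    with le have le': "(\<integral>\<^sup>+p. log 2 (1 + W (fst p) (snd p) / r (snd p)) \<partial>joint_law \<mu> Q) \<le> ennreal (L + 1)"
      by (rule order_trans)
    \<comment> \<open>Up to a factor \<open>ln 2\<close> this choice minimises
      \<open>- log 2 a + a * (L + 1)\<close>; it is at most 1 because \<open>L\<close> is
      nonnegative.\<close>
    define a where "a = 1 / (L + 1)"
    have a: "0 < a" "a \<le> 1" using L0 by (auto simp: a_def)
    have p\<mu>: "prob_space \<mu>" "sets \<mu> = sets borel" using prob[OF \<mu>] by (auto simp: borel_prob_def)
    obtain G where G: "G \<in> borel_measurable borel"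
      "\<And>\<omega>. disc_entropy (distr \<mu> borel (\<lambda>x. pick R (W x) \<omega>)) \<le> G \<omega>"
      "(\<integral>\<^sup>+\<omega>. G \<omega> \<partial>array R) \<le> ennreal (2 - log 2 a + (1 + a) * (L + 1))"
      using disc_entropy_majorant[OF a L0 r p\<mu> prob_space_joint_law[OF prob[OF \<mu>] assms(3)] P_eq[OF \<mu>] r_pos le']
      by blast
    have "cond_entropy (distr (\<mu> \<Otimes>\<^sub>M \<nu>) (borel \<Otimes>\<^sub>M borel) (\<lambda>(x, z). (g x z, z)))
        \<le> (\<integral>\<^sup>+z. disc_entropy (distr \<mu> borel (\<lambda>x. g x z)) \<partial>\<nu>)"
      by (rule cond_entropy_distr_le[OF prob[OF \<mu>] \<nu> g])
    \<comment> \<open>The majorant is composed with the decoder, so that the integral over the real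
      line can be pulled back to the array, where \<open>d\<close> undoes \<open>e\<close>.\<close>
    also have "\<dots> \<le> (\<integral>\<^sup>+z. G (d z) \<partial>\<nu>)"
      unfolding g_def by (intro nn_integral_mono G(2))
    also have "\<dots> = (\<integral>\<^sup>+\<omega>. G (d (e \<omega>)) \<partial>array R)"
      unfolding \<nu>_def using measurable_compose[OF d G(1)] by (intro nn_integral_distr em) simp
    also have "\<dots> = (\<integral>\<^sup>+\<omega>. G \<omega> \<partial>array R)" by (simp only: de)
    also note G(3)
    \<comment> \<open>The constant 4 consists of two bits for the row, one bit for passing from
      \<open>log (1 + v)\<close> to \<open>log v\<close>, and
      \<open>a * (L + 1) = 1\<close>.\<close>
    also have "2 - log 2 a + (1 + a) * (L + 1) = L + log 2 (L + 1) + 4"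
    proof -
      have "a * (L + 1) = 1" using L0 by (simp add: a_def)
      moreover have "log 2 a = - log 2 (L + 1)" using L0 by (simp add: a_def log_divide)
      ultimately show ?thesis by (simp add: distrib_right)
    qed
    \<comment> \<open>As \<open>card S\<close> is at least 1, the factor only enlarges the argument
      of the logarithm.\<close>
    also have "ennreal \<dots> \<le> ennreal (L + log 2 (real (card S) * (L + 1)) + 4)"
    proof (intro ennreal_leI add_mono order_refl)
      have "1 * (L + 1) \<le> real (card S) * (L + 1)" using card L0 by (intro mult_right_mono) auto
      then show "log 2 (L + 1) \<le> log 2 (real (card S) * (L + 1))" using L0 by (intro log_mono) auto
    qed
    finally show ?thesis .
  qed
  ultimately show ?thesis
    unfolding L_def[symmetric] using \<nu> g by (intro exI[of _ \<nu>] exI[of _ g]) blast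
qed

end
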